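(* For any $\omega\in(\mathbb R\setminus\mathbb Q)/\mathbb Z$ and any non-zero $\beta\in\mathbb R$, there is a residual subset $\mathcal U_\beta\subset C^0(\mathbb T)$ such that for every $q\in\mathcal U_\beta$, the set $$\{(\tau,\alpha)\in\mathbb R\times(0,1)\mid f_{\alpha,\beta,\tau,q}\text{ is mode-locked}\}$$ is an open and dense subset of $\mathbb R\times(0,1)$, where $$f_{\alpha,\beta,\tau,q}:\mathbb T^2\to\mathbb T^2,\qquad (\theta,x)\mapsto\Big(\theta+\omega,\ x+\tau+\frac{\alpha}{2\pi}\sin(2\pi x)+\beta q(\theta)\bmod 1\Big).$$
   Context: $\mathbb T=\mathbb R/\mathbb Z$; $C^0(\mathbb T)$ is the space of continuous functions $\mathbb T\to\mathbb R$ with the uniform topology. Let $g:\mathbb T\to\mathbb T$, $g(\theta)=\theta+\omega$. A map $f:\mathbb T\times\mathbb T\to\mathbb T\times\mathbb T$ is a $g$-forced circle homeomorphism if there is a homeomorphism $F:\mathbb T\times\mathbb R\to\mathbb T\times\mathbb R$, $F(\theta,w)=(g(\theta),F_\theta(w))$, with every $F_\theta$ an orientation preserving homeomorphism of $\mathbb R$, such that $(\mathrm{Id}\times\pi)\circ F=f\circ(\mathrm{Id}\times\pi)$, where $\pi:\mathbb R\to\mathbb T$ is the projection; $F$ is called a lift of $f$. With $\pi_2$ the projection to the second coordinate, the limit $\rho(F)=\lim_{n\to+\infty}\pi_2F^n(\theta,w)/n$ exists and is independent of $(\theta,w)$; $\rho(f)=\rho(F)\bmod 1$ is independent of the lift.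 $f$ is mode-locked if $\rho(f')=\rho(f)$ for every $g$-forced circle homeomorphism $f'$ sufficiently close to $f$ in the $C^0$ topology. *)

theory Defs
  imports "HOL-Analysis.Analysis"
begin

section \<open>The circle $\mathbb{R}/\mathbb{Z}$\<close>

quotient_type circle = real / "\<lambda>x y :: real. x - y \<in> \<int>"
  morphisms rep_circle to_circle
proof (rule equivpI)
  show "reflp (\<lambda>x y :: real. x - y \<in> \<int>)"
    by (simp add: reflp_def)
  show "symp (\<lambda>x y :: real. x - y \<in> \<int>)"
  proof (rule sympI)
    fix x y :: real
    assume "x - y \<in> \<int>"
    from Ints_minus[OF this] show "y - x \<in> \<int>" by simp
  qed
  show "transp (\<lambda>x y :: real. x - y \<in> \<int>)"
  proof (rule transpI)
    fix x y z :: real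
    assume "x - y \<in> \<int>" "y - z \<in> \<int>"
    from Ints_add[OF this] show "x - z \<in> \<int>" by simp
  qed
qed

instantiation circle :: ab_group_add
begin

lift_definition zero_circle :: circle is "0 :: real" .

lift_definition plus_circle :: "circle \<Rightarrow> circle \<Rightarrow> circle" is "(+) :: real \<Rightarrow> _"
proof -
  fix a b c d :: real
  assume "a - b \<in> \<int>" "c - d \<in> \<int>"
  from Ints_add[OF this] show "a + c - (b + d) \<in> \<int>" by (simp add: algebra_simps)
qed

lift_definition uminus_circle :: "circle \<Rightarrow> circle" is "uminus :: real \<Rightarrow> _"
proof -
  fix a b :: real
  assume "a - b \<in> \<int>"
  from Ints_minus[OF this] show "- a - - b \<in> \<int>" by simp
qed

lift_definition minus_circle :: "circle \<Rightarrow> circle \<Rightarrow> circle" is "(-) :: real \<Rightarrow> _"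
proof -
  fix a b c d :: real
  assume "a - b \<in> \<int>" "c - d \<in> \<int>"
  from Ints_diff[OF this] show "a - c - (b - d) \<in> \<int>" by (simp add: algebra_simps)
qed

instance
  by standard (transfer, simp)+

end

text \<open>The metric is the distance of real representatives modulo the integers.\<close>

lemma dist_round_add: "\<bar>x + y - of_int (round (x + y))\<bar>
    \<le> \<bar>x - of_int (round x)\<bar> + \<bar>y - of_int (round y)\<bar>" for x y :: real
  using round_diff_minimal[of "x + y" "round x + round y"] by simp

lemma dist_round_minus: "\<bar>- x - of_int (round (- x))\<bar> = \<bar>x - of_int (round x)\<bar>" for x :: real
  using round_diff_minimal[of "- x" "- round x"] round_diff_minimal[of x "- round (- x)"]
  by simp

instantiation circle :: metric_space
begin

lift_definition dist_circle :: "circle \<Rightarrow> circle \<Rightarrow> real"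
  is "\<lambda>x y. \<bar>(x - y) - of_int (round (x - y))\<bar>"
proof -
  fix a b c d :: real
  assume "a - b \<in> \<int>" "c - d \<in> \<int>"
  from Ints_diff[OF this] obtain k :: int where "a - b - (c - d) = of_int k"
    by (auto elim: Ints_cases)
  then have k: "a - c = (b - d) + of_int k" by simp
  show "\<bar>a - c - of_int (round (a - c))\<bar> = \<bar>b - d - of_int (round (b - d))\<bar>"
    unfolding k
    using round_diff_minimal[of "b - d + of_int k" "round (b - d) + k"]
      round_diff_minimal[of "b - d" "round (b - d + of_int k) - k"]
    by simp
qed

definition uniformity_circle :: "(circle \<times> circle) filter"
  where "uniformity_circle = (INF e\<in>{0 <..}. principal {(x, y). dist x y < e})"

definition open_circle :: "circle set \<Rightarrow> bool"
  where "open_circle S = (\<forall>x\<in>S. \<forall>\<^sub>F (x', y) in uniformity. x' = x \<longrightarrow> y \<in> S)"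

instance
proof
  show "(dist x y = 0) = (x = y)" for x y :: circle
  proof (transfer, safe)
    fix x y :: real
    assume "\<bar>x - y - of_int (round (x - y))\<bar> = 0"
    then have "x - y = of_int (round (x - y))" by simp
    then show "x - y \<in> \<int>" by (metis Ints_of_int)
  next
    fix x y :: real
    assume "x - y \<in> \<int>"
    then show "\<bar>x - y - of_int (round (x - y))\<bar> = 0" by (auto elim: Ints_cases)
  qed
  show "dist x y \<le> dist x z + dist y z" for x y z :: circle
  proof transfer
    fix x y z :: real
    show "\<bar>x - y - of_int (round (x - y))\<bar>
      \<le> \<bar>x - z - of_int (round (x - z))\<bar> + \<bar>y - z - of_int (round (y - z))\<bar>"
      using dist_round_add[of "x - z" "z - y"] dist_round_minus[of "y - z"] by simp
  qed
qed (fact uniformity_circle_def open_circle_def)+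

end

lemma to_circle_cases: obtains x where "c = to_circle x"
  using Quotient_abs_rep[OF Quotient_circle, of c] by metis

lemma dist_to_circle_le: "dist (to_circle x) (to_circle y) \<le> \<bar>x - y\<bar>"
  using round_diff_minimal[of "x - y" 0] by (simp add: dist_circle.abs_eq)

lemma continuous_on_to_circle: "continuous_on S to_circle"
proof (rule continuous_onI)
  fix x and e :: real
  assume "0 < e"
  moreover have "dist (to_circle x') (to_circle x) \<le> e" if "dist x' x < e" for x'
    using dist_to_circle_le[of x' x] that by (simp add: dist_real_def)
  ultimately show "\<exists>d>0. \<forall>x'\<in>S. dist x' x < d \<longrightarrow> dist (to_circle x') (to_circle x) \<le> e"
    by blast
qed

lemma open_circle_iff_quotient: "open U \<longleftrightarrow> open (to_circle -` U)"
proof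
  assume "open U"
  then show "open (to_circle -` U)"
    by (rule open_vimage) (rule continuous_on_to_circle)
next
  assume *: "open (to_circle -` U)"
  show "open U"
    unfolding open_dist
  proof
    fix c assume "c \<in> U"
    obtain x where x: "c = to_circle x" by (rule to_circle_cases)
    with \<open>c \<in> U\<close> have "x \<in> to_circle -` U" by simp
    then obtain e where e: "e > 0" "\<And>y. dist y x < e \<Longrightarrow> to_circle y \<in> U"
      using * unfolding open_dist by auto
    have "d \<in> U" if d: "dist d c < e" for d
    proof -
      obtain z where z: "d = to_circle z" by (rule to_circle_cases)
      have "dist (z - of_int (round (z - x))) x < e"
        using d unfolding x z dist_circle.abs_eq dist_real_def by (simp add: algebra_simps)
      then have "to_circle (z - of_int (round (z - x))) \<in> U" by (rule e)
      moreover have "to_circle (z - of_int (round (z - x))) = d"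
        unfolding z by (simp add: circle.abs_eq_iff)
      ultimately show ?thesis by simp
    qed
    with e show "\<exists>e>0. \<forall>y. dist y c < e \<longrightarrow> y \<in> U" by blast
  qed
qed

lemma compact_UNIV_circle: "compact (UNIV :: circle set)"
proof -
  have "c \<in> to_circle ` {0..1}" for c
  proof -
    obtain x where x: "c = to_circle x" by (rule to_circle_cases)
    have "c = to_circle (frac x)" unfolding x by (simp add: circle.abs_eq_iff frac_def)
    moreover have "frac x \<in> {0..1}" by (simp add: less_imp_le[OF frac_lt_1])
    ultimately show ?thesis by blast
  qed
  then have "UNIV = to_circle ` {0..1}" by blast
  then show ?thesis
    using compact_continuous_image[OF continuous_on_to_circle compact_Icc[of 0 1]] by simp
qed

text \<open>Since the circle is compact, the type \<open>circle \<Rightarrow>\<^sub>C real\<close> of bounded continuous functions,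
  with its uniform metric, is the space of all continuous functions.\<close>

lemma bcontfun_circle_iff: "q \<in> bcontfun \<longleftrightarrow> continuous_on UNIV q" for q :: "circle \<Rightarrow> real"
  unfolding bcontfun_def
  using compact_continuous_image[OF _ compact_UNIV_circle, of q] compact_imp_bounded by blast

lift_definition sin_circle :: "circle \<Rightarrow> real" is "\<lambda>x. sin (2 * pi * x)"
proof -
  fix x y :: real
  assume "x - y \<in> \<int>"
  then obtain k :: int where "x - y = of_int k" by (auto elim: Ints_cases)
  then have x: "x = y + of_int k" by simp
  have "sin (2 * pi * of_int k) = 0" "cos (2 * pi * of_int k) = 1"
    by (simp_all add: sin_int_2pin cos_int_2pin)
  then show "sin (2 * pi * x) = sin (2 * pi * y)"
    unfolding x distrib_left sin_add by simp
qed

section \<open>Residual sets\<close>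

definition residual :: "'a::topological_space set \<Rightarrow> bool" where
  "residual U \<longleftrightarrow> (\<exists>\<G>. countable \<G> \<and> (\<forall>G\<in>\<G>. open G \<and> closure G = UNIV) \<and> \<Inter>\<G> \<subseteq> U)"

section \<open>Forced circle homeomorphisms over the rotation by \<open>\<omega>\<close>\<close>

definition forced_lift ::
  "circle \<Rightarrow> (circle \<times> circle \<Rightarrow> circle \<times> circle) \<Rightarrow> (circle \<times> real \<Rightarrow> circle \<times> real) \<Rightarrow> bool"
  where
  "forced_lift \<omega> f F \<longleftrightarrow>
     (\<exists>G. homeomorphism UNIV UNIV F G) \<and>
     (\<forall>\<theta> w. fst (F (\<theta>, w)) = \<theta> + \<omega>) \<and>
     (\<forall>\<theta>. strict_mono (\<lambda>w. snd (F (\<theta>, w))) \<and>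
          (\<exists>h. homeomorphism UNIV UNIV (\<lambda>w. snd (F (\<theta>, w))) h)) \<and>
     map_prod id to_circle \<circ> F = f \<circ> map_prod id to_circle"

text \<open>A lift \<open>F\<close> alone satisfies \<open>F\<^sub>\<theta> (w + 1) = F\<^sub>\<theta> w + d\<close> with some \<open>d \<ge> 1\<close>.  That \<open>f\<close> itself
  is a homeomorphism amounts to \<open>d = 1\<close>, without which there is no rotation number (consider
  the doubling map on the fibres).\<close>

definition forced_circle_homeo :: "circle \<Rightarrow> (circle \<times> circle \<Rightarrow> circle \<times> circle) \<Rightarrow> bool" where
  "forced_circle_homeo \<omega> f \<longleftrightarrow>
     (\<exists>g. homeomorphism UNIV UNIV f g) \<and> (\<exists>F. forced_lift \<omega> f F)"

definition lift_rotation_number :: "(circle \<times> real \<Rightarrow> circle \<times> real) \<Rightarrow> real" where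
  "lift_rotation_number F =
     (THE r. \<forall>\<theta> w. (\<lambda>n. snd ((F ^^ n) (\<theta>, w)) / real n) \<longlonglongrightarrow> r)"

definition rotation_number :: "circle \<Rightarrow> (circle \<times> circle \<Rightarrow> circle \<times> circle) \<Rightarrow> circle" where
  "rotation_number \<omega> f =
     (THE r. \<forall>F. forced_lift \<omega> f F \<longrightarrow> to_circle (lift_rotation_number F) = r)"

text \<open>The torus being compact, the $C^0$ topology is that of uniform distance.\<close>

definition mode_locked :: "circle \<Rightarrow> (circle \<times> circle \<Rightarrow> circle \<times> circle) \<Rightarrow> bool" where
  "mode_locked \<omega> f \<longleftrightarrow>
     forced_circle_homeo \<omega> f \<and>
     (\<exists>\<epsilon>>0. \<forall>f'. forced_circle_homeo \<omega> f' \<and> (\<forall>z. dist (f' z) (f z) < \<epsilon>)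
        \<longrightarrow> rotation_number \<omega> f' = rotation_number \<omega> f)"

definition forced_arnold_map ::
  "circle \<Rightarrow> real \<Rightarrow> real \<Rightarrow> real \<Rightarrow> (circle \<Rightarrow> real) \<Rightarrow> circle \<times> circle \<Rightarrow> circle \<times> circle" where
  "forced_arnold_map \<omega> \<alpha> \<beta> \<tau> q =
     (\<lambda>(\<theta>, x). (\<theta> + \<omega>, x + to_circle (\<tau> + \<alpha> / (2 * pi) * sin_circle x + \<beta> * q \<theta>)))"

end

theory Submission
  imports Defs
begin

text \<open>
  Put \<open>\<phi> = \<tau> + \<beta> q\<close> and consider the lift \<open>F\<^sub>\<phi>(\<theta>, w) = (\<theta> + \<omega>, w + \<phi>(\<theta>) + \<alpha>/(2\<pi>) sin(2\<pi>w))\<close>.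
  For one fixed pair \<open>(\<tau>, \<alpha>)\<close> the forcings \<open>q\<close> with a mode-locked map form an open set, and the
  heart of the matter is that this set is dense (\<open>mode_locked_dense\<close>).  Intersecting over a countable
  dense set of parameters gives the residual set: for each of its members the mode-locked parameters
  contain a dense set, and they are open because mode-locking is stable under \<open>C\<^sup>0\<close>-small changes.

  Density is obtained as follows.  Rotation numbers of lifts exist (\<open>rotation_exists\<close>) and are monotone
  in the lift, so if \<open>F\<^bsub>\<phi>-\<epsilon>\<^esub>\<close> and \<open>F\<^bsub>\<phi>+\<epsilon>\<^esub>\<close> have the same rotation number, then so has every lift squeezed
  between them, and the given map is already mode-locked (\<open>mode_lockedI\<close>).  Otherwise some \<open>r = k + d\<omega>\<close>
  lies strictly between the two rotation numbers.  In the coordinate \<open>w - d\<theta>\<close>, and after subtracting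
  \<open>r\<close>, the lower map drifts downwards and the upper map drifts upwards.  Taking a lower envelope
  along the upper map and then an upper envelope along the lower map produces a continuous curve
  \<open>\<gamma>\<close> whose image under the given map is within \<open>\<epsilon>\<close> of \<open>\<gamma>\<close> (\<open>approximately_invariant_curve\<close>).  The
  forcing acts on the fibres by translations, so changing it by at most \<open>\<epsilon>\<close> makes \<open>\<gamma>\<close> invariant.

  The freedom in \<open>\<gamma>\<close> is used once more to make its fibred Lyapunov exponent non-zero
  (\<open>nonzero_exponent_curve\<close>): replacing \<open>x\<close> by \<open>x - s sin(2\<pi>x)\<close> along the curve increases the fibre
  derivative \<open>1 + \<alpha> cos(2\<pi>x)\<close>.  An invariant curve with non-zero exponent is uniformly attracting or
  uniformly repelling, and on both sides of it there are curves that the orbits of slightly raised and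
  slightly lowered maps do not cross (\<open>hyperbolic_curve_locks\<close>).  Both maps then have rotation number
  \<open>r\<close>, and the first criterion applies to the perturbed forcing.
\<close>

section \<open>The circle as a topological group\<close>

lemma dist_circle_diff: "dist a b = dist (a - b) (0 :: circle)"
  by transfer simp

lemma dist_circle_add_right [simp]: "dist (a + c) (b + c) = dist a (b :: circle)"
  by (simp add: dist_circle_diff[of "a + c"] dist_circle_diff[of a])

lemma dist_circle_add_left [simp]: "dist (c + a) (c + b) = dist a (b :: circle)"
  by (simp add: dist_circle_diff[of "c + a"] dist_circle_diff[of a])

lemma dist_circle_minus [simp]: "dist (- a) (- b) = dist a (b :: circle)"
proof -
  have "dist (- a) (- b) = dist (- a + (a + b)) (- b + (a + b))"
    by (simp only: dist_circle_add_right)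
  also have "\<dots> = dist a b"
    by (simp add: dist_commute)
  finally show ?thesis .
qed

lemma dist_circle_add_le: "dist (a + b) (c + d) \<le> dist a c + dist b (d :: circle)"
  using dist_triangle[of "a + b" "c + d" "c + b"] by simp

instance circle :: topological_ab_group_add
proof
  fix a b :: circle
  show "LIM x (nhds a \<times>\<^sub>F nhds b). fst x + snd x :> nhds (a + b)"
  proof (rule tendstoI)
    fix e :: real assume "e > 0"
    have "\<forall>\<^sub>F x in nhds a. dist x a < e / 2" "\<forall>\<^sub>F y in nhds b. dist y b < e / 2"
      using \<open>e > 0\<close> by (auto simp: eventually_nhds_metric intro!: exI[of _ "e / 2"])
    then have "\<forall>\<^sub>F z in nhds a \<times>\<^sub>F nhds b. dist (fst z) a < e / 2 \<and> dist (snd z) b < e / 2"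
      by (auto simp: eventually_prod_filter)
    then show "\<forall>\<^sub>F z in nhds a \<times>\<^sub>F nhds b. dist (fst z + snd z) (a + b) < e"
    proof eventually_elim
      case (elim z)
      then show ?case
        using dist_circle_add_le[of "fst z" "snd z" a b] by linarith
    qed
  qed
  show "(uminus \<longlongrightarrow> - a) (nhds a)"
    by (rule tendstoI) (auto simp: eventually_nhds_metric)
qed

lemma to_circle_add: "to_circle (x + y) = to_circle x + to_circle y"
  by (simp add: plus_circle.abs_eq)

lemma to_circle_of_int [simp]: "to_circle (of_int k) = 0"
  by (simp add: zero_circle.abs_eq circle.abs_eq_iff zero_circle_def)

lemma to_circle_1 [simp]: "to_circle 1 = 0"
  using to_circle_of_int[of 1] by simp

lemma to_circle_0 [simp]: "to_circle 0 = 0"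
  using to_circle_of_int[of 0] by simp

lemma to_circle_eq_iff: "to_circle x = to_circle y \<longleftrightarrow> (\<exists>k :: int. x = y + of_int k)"
proof -
  have "to_circle x = to_circle y \<longleftrightarrow> x - y \<in> \<int>"
    by (simp add: circle.abs_eq_iff)
  also have "\<dots> \<longleftrightarrow> (\<exists>k :: int. x - y = of_int k)"
    by (auto elim: Ints_cases)
  also have "\<dots> \<longleftrightarrow> (\<exists>k :: int. x = y + of_int k)"
    by (simp add: algebra_simps)
  finally show ?thesis .
qed

text \<open>The multiple \<open>n \<cdot> \<omega>\<close> gives the positions along an orbit of the rotation, and \<open>\<theta> \<mapsto> d \<cdot> \<theta>\<close> is the
  covering of degree \<open>d\<close> by which the fibres are twisted later.\<close>

primrec nmul :: "nat \<Rightarrow> circle \<Rightarrow> circle" (infixl "\<cdot>" 75) where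
  "0 \<cdot> c = 0"
| "Suc n \<cdot> c = n \<cdot> c + c"

lemma nmul_add: "(m + n) \<cdot> c = m \<cdot> c + n \<cdot> c"
  by (induction m) (simp_all add: algebra_simps)

lemma nmul_to_circle: "n \<cdot> to_circle x = to_circle (real n * x)"
  by (induction n) (simp_all add: algebra_simps to_circle_add)

lemma continuous_on_nmul [continuous_intros]:
  "continuous_on S f \<Longrightarrow> continuous_on S (\<lambda>x. n \<cdot> f x)"
  by (induction n) (auto intro!: continuous_intros)

lemma continuous_on_to_circle' [continuous_intros]:
  "continuous_on S f \<Longrightarrow> continuous_on S (\<lambda>x. to_circle (f x))"
  by (rule continuous_on_compose2[OF continuous_on_to_circle]) auto

lemma continuous_on_circle_iff:
  "continuous_on UNIV f \<longleftrightarrow> continuous_on UNIV (\<lambda>x. f (to_circle x))"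
  for f :: "circle \<Rightarrow> 'a::topological_space"
proof
  assume "continuous_on UNIV f"
  then show "continuous_on UNIV (\<lambda>x. f (to_circle x))"
    by (rule continuous_on_compose2) (auto intro!: continuous_intros)
next
  assume *: "continuous_on UNIV (\<lambda>x. f (to_circle x))"
  have "open (f -` U)" if "open U" for U
  proof -
    have "open ((\<lambda>x. f (to_circle x)) -` U)"
      using * that by (simp add: open_vimage)
    then show ?thesis
      by (simp add: open_circle_iff_quotient vimage_def)
  qed
  then show "continuous_on UNIV f"
    by (simp add: continuous_on_open_vimage)
qed

lemma sin_circle_to_circle [simp]: "sin_circle (to_circle x) = sin (2 * pi * x)"
  by (rule sin_circle.abs_eq)

lemma continuous_on_sin_circle [continuous_intros]:
  assumes "continuous_on S f"
  shows "continuous_on S (\<lambda>x. sin_circle (f x))"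
proof -
  have "continuous_on UNIV sin_circle"
    unfolding continuous_on_circle_iff by (auto intro!: continuous_intros)
  from continuous_on_compose2[OF this assms] show ?thesis by simp
qed

lemma abs_sin_circle_le [simp]: "\<bar>sin_circle c\<bar> \<le> 1"
  by (cases c rule: to_circle_cases) simp

lemma abs_sin_circle_diff_le:
  "\<bar>sin_circle (to_circle x + c) - sin_circle (to_circle y + c)\<bar> \<le> 2 * pi * \<bar>x - y\<bar>"
proof -
  obtain s where s: "c = to_circle s" by (rule to_circle_cases)
  have "\<bar>sin (2 * pi * (x + s)) - sin (2 * pi * (y + s))\<bar>
      = 2 * \<bar>sin ((2 * pi * (x + s) - 2 * pi * (y + s)) / 2)\<bar> * \<bar>cos ((2 * pi * (x + s) + 2 * pi * (y + s)) / 2)\<bar>"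
    unfolding sin_diff_sin by (simp add: abs_mult)
  also have "\<dots> \<le> 2 * \<bar>sin ((2 * pi * (x + s) - 2 * pi * (y + s)) / 2)\<bar>"
    by (simp add: mult_left_le)
  also have "\<dots> \<le> 2 * \<bar>(2 * pi * (x + s) - 2 * pi * (y + s)) / 2\<bar>"
    by (intro mult_left_mono abs_sin_x_le_abs_x) simp
  also have "\<dots> = 2 * pi * \<bar>x - y\<bar>"
    by (simp add: abs_mult flip: right_diff_distrib)
  finally show ?thesis
    by (simp add: s flip: to_circle_add)
qed

lemma circle_bounded:
  fixes f :: "circle \<Rightarrow> real"
  assumes "continuous_on UNIV f"
  obtains B where "B > 0" "\<And>\<theta>. \<bar>f \<theta>\<bar> \<le> B"
proof -
  have "bounded (range f)"
    by (rule compact_imp_bounded) (rule compact_continuous_image[OF assms compact_UNIV_circle])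
  then obtain B where "B > 0" "\<forall>x\<in>range f. norm x \<le> B"
    unfolding bounded_pos by blast
  with that show ?thesis by force
qed

lemma circle_pos_lower_bound:
  fixes f :: "circle \<Rightarrow> real"
  assumes "continuous_on UNIV f" "\<And>\<theta>. f \<theta> > 0"
  obtains c where "c > 0" "\<And>\<theta>. c \<le> f \<theta>"
proof -
  obtain \<theta>\<^sub>0 where "\<And>\<theta>. f \<theta>\<^sub>0 \<le> f \<theta>"
    using continuous_attains_inf[OF compact_UNIV_circle _ assms(1)] by auto
  then show ?thesis
    using that[of "f \<theta>\<^sub>0"] assms(2) by blast
qed

section \<open>Irrational rotations and Birkhoff sums\<close>

locale irrational_rotation =
  fixes \<omega> :: circle
  assumes irrational: "\<omega> \<in> to_circle ` (UNIV - \<rat>)"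
begin

lemma real_rep: obtains w where "w \<notin> \<rat>" "\<omega> = to_circle w"
  using irrational by auto

text \<open>Multiples with natural \<open>d\<close> are enough for density, so that the twisting degrees below are
  natural numbers and the orbits are forward orbits.\<close>

lemma lattice_dense:
  assumes "w \<notin> \<rat>" "(a :: real) < b"
  obtains d :: nat and k :: int where "a < of_int k + real d * w" "of_int k + real d * w < b"
proof -
  obtain h k where k: "k > 0" "\<bar>of_int k * w - of_int h - (a + b) / 2\<bar> < (b - a) / 2"
    by (rule sequence_of_fractional_parts_is_dense[of w "(b - a) / 2" "(a + b) / 2"]) (use assms in auto)
  show ?thesis
  proof
    show "a < of_int (- h) + real (nat k) * w" "of_int (- h) + real (nat k) * w < b"
      using k by (auto simp: abs_less_iff field_simps)
  qed
qed

lemma orbit_dense: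
  assumes "\<delta> > 0"
  obtains n where "dist (n \<cdot> \<omega>) c < \<delta>"
proof -
  obtain w where w: "w \<notin> \<rat>" "\<omega> = to_circle w" by (rule real_rep)
  obtain x where x: "c = to_circle x" by (rule to_circle_cases)
  obtain d k where "x - \<delta> < of_int k + real d * w" "of_int k + real d * w < x + \<delta>"
    by (rule lattice_dense[OF w(1), of "x - \<delta>" "x + \<delta>"]) (use assms in auto)
  then have "\<bar>real d * w + of_int k - x\<bar> < \<delta>"
    by (simp add: abs_less_iff)
  then have "dist (to_circle (real d * w + of_int k)) c < \<delta>"
    unfolding x using dist_to_circle_le order_le_less_trans by blast
  then have "dist (d \<cdot> \<omega>) c < \<delta>"
    by (simp add: to_circle_add w nmul_to_circle)
  then show ?thesis by (rule that)
qed

text \<open>Finitely many points of the orbit of \<open>0\<close> are \<open>\<delta>\<close>-dense by compactness, and since the metric is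
  invariant under translations the same number of steps works for every initial point.\<close>

lemma uniformly_minimal:
  assumes "\<delta> > 0"
  obtains K where "\<And>\<theta> \<theta>'. \<exists>k\<le>K. dist (\<theta> + k \<cdot> \<omega>) \<theta>' < \<delta>"
proof -
  have "UNIV \<subseteq> (\<Union>n. ball (n \<cdot> \<omega>) \<delta>)"
  proof
    fix c
    obtain n where "dist (n \<cdot> \<omega>) c < \<delta>" by (rule orbit_dense[OF assms])
    then show "c \<in> (\<Union>n. ball (n \<cdot> \<omega>) \<delta>)" by auto
  qed
  then obtain N where N: "finite N" "UNIV \<subseteq> (\<Union>n\<in>N. ball (n \<cdot> \<omega>) \<delta>)"
    using compactE_image[OF compact_UNIV_circle, of UNIV "\<lambda>n. ball (n \<cdot> \<omega>) \<delta>"] by auto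
  show ?thesis
  proof
    fix \<theta> \<theta>'
    obtain k where k: "k \<in> N" "dist (k \<cdot> \<omega>) (\<theta>' - \<theta>) < \<delta>"
      using subsetD[OF N(2), of "\<theta>' - \<theta>"] by auto
    have "dist (\<theta> + k \<cdot> \<omega>) (\<theta> + (\<theta>' - \<theta>)) < \<delta>"
      using k(2) by (simp only: dist_circle_add_left)
    then show "\<exists>k\<le>Max N. dist (\<theta> + k \<cdot> \<omega>) \<theta>' < \<delta>"
      using k(1) N(1) by (intro exI[of _ k]) simp
  qed
qed

end

definition birkhoff :: "circle \<Rightarrow> (circle \<Rightarrow> real) \<Rightarrow> nat \<Rightarrow> circle \<Rightarrow> real" where
  "birkhoff \<omega> g n \<theta> = (\<Sum>i<n. g (\<theta> + i \<cdot> \<omega>))"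

lemma birkhoff_shift: "birkhoff \<omega> g n (\<theta> + k \<cdot> \<omega>) + birkhoff \<omega> g k \<theta> = birkhoff \<omega> g (n + k) \<theta>"
proof (induction n)
  case 0
  then show ?case by (simp add: birkhoff_def)
next
  case (Suc n)
  have "\<theta> + k \<cdot> \<omega> + n \<cdot> \<omega> = \<theta> + (n + k) \<cdot> \<omega>"
    by (simp add: nmul_add algebra_simps)
  then have "g (\<theta> + k \<cdot> \<omega> + n \<cdot> \<omega>) = g (\<theta> + (n + k) \<cdot> \<omega>)"
    by (simp only:)
  then show ?case
    using Suc by (simp add: birkhoff_def)
qed

lemma birkhoff_abs_le:
  assumes "\<And>\<theta>. \<bar>g \<theta>\<bar> \<le> B"
  shows "\<bar>birkhoff \<omega> g n \<theta>\<bar> \<le> real n * B"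
proof -
  have "\<bar>birkhoff \<omega> g n \<theta>\<bar> \<le> (\<Sum>i<n. \<bar>g (\<theta> + i \<cdot> \<omega>)\<bar>)"
    unfolding birkhoff_def by (rule sum_abs)
  also have "\<dots> \<le> (\<Sum>i<n. B)"
    by (rule sum_mono) (rule assms)
  finally show ?thesis by simp
qed

lemma continuous_on_birkhoff [continuous_intros]:
  assumes "continuous_on UNIV g"
  shows "continuous_on UNIV (birkhoff \<omega> g n)"
  unfolding birkhoff_def
  by (intro continuous_intros continuous_on_compose2[OF assms]) auto

text \<open>This is the unique ergodicity of the rotation.  Following the orbit of \<open>\<theta>\<close> until it comes close to
  \<open>\<theta>'\<close> changes the sum by a bounded amount only; from then on the two orbits stay close because the
  rotation is an isometry, and the summands differ by at most \<open>e / 2\<close>.\<close>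

lemma (in irrational_rotation) birkhoff_oscillation:
  assumes g: "continuous_on UNIV g" and "e > 0"
  obtains n\<^sub>0 where "\<And>n \<theta> \<theta>'. n \<ge> n\<^sub>0 \<Longrightarrow> \<bar>birkhoff \<omega> g n \<theta> - birkhoff \<omega> g n \<theta>'\<bar> \<le> e * real n"
proof -
  obtain B where B: "B > 0" "\<And>\<theta>. \<bar>g \<theta>\<bar> \<le> B"
    using circle_bounded[OF g] by blast
  have "uniformly_continuous_on UNIV g"
    by (rule compact_uniformly_continuous[OF g compact_UNIV_circle])
  then obtain \<delta> where \<delta>: "\<delta> > 0" "\<And>\<theta> \<theta>'. dist \<theta> \<theta>' < \<delta> \<Longrightarrow> dist (g \<theta>) (g \<theta>') < e / 2"
    unfolding uniformly_continuous_on_def using \<open>e > 0\<close> by (metis UNIV_I half_gt_zero)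
  obtain K where K: "\<And>\<theta> \<theta>'. \<exists>k\<le>K. dist (\<theta> + k \<cdot> \<omega>) \<theta>' < \<delta>"
    using uniformly_minimal[OF \<delta>(1)] by blast
  obtain n\<^sub>0 where n\<^sub>0: "real n\<^sub>0 > 2 * real K * B / (e / 2)"
    using reals_Archimedean2 by blast
  show ?thesis
  proof
    fix n \<theta> \<theta>' assume n: "n \<ge> n\<^sub>0"
    obtain k where k: "k \<le> K" "dist (\<theta> + k \<cdot> \<omega>) \<theta>' < \<delta>"
      using K by blast
    have "\<bar>birkhoff \<omega> g n (\<theta> + k \<cdot> \<omega>) - birkhoff \<omega> g n \<theta>'\<bar>
        \<le> (\<Sum>i<n. \<bar>g (\<theta> + k \<cdot> \<omega> + i \<cdot> \<omega>) - g (\<theta>' + i \<cdot> \<omega>)\<bar>)"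
      unfolding birkhoff_def by (simp add: sum_abs flip: sum_subtractf)
    also have "\<dots> \<le> (\<Sum>i<n. e / 2)"
      using \<delta>(2)[of "\<theta> + k \<cdot> \<omega> + i \<cdot> \<omega>" "\<theta>' + i \<cdot> \<omega>" for i] k(2)
      by (intro sum_mono) (auto simp: dist_real_def intro: less_imp_le)
    finally have 1: "\<bar>birkhoff \<omega> g n (\<theta> + k \<cdot> \<omega>) - birkhoff \<omega> g n \<theta>'\<bar> \<le> e / 2 * real n"
      by (simp add: mult.commute)
    have "birkhoff \<omega> g n (\<theta> + k \<cdot> \<omega>) - birkhoff \<omega> g n \<theta>
        = birkhoff \<omega> g k (\<theta> + n \<cdot> \<omega>) - birkhoff \<omega> g k \<theta>"
      using birkhoff_shift[of \<omega> g n \<theta> k] birkhoff_shift[of \<omega> g k \<theta> n] by (simp add: add.commute)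
    moreover have "\<bar>birkhoff \<omega> g k (\<theta> + n \<cdot> \<omega>) - birkhoff \<omega> g k \<theta>\<bar> \<le> 2 * (real k * B)"
      using birkhoff_abs_le[of g B, OF B(2), of \<omega> k "\<theta> + n \<cdot> \<omega>"]
        birkhoff_abs_le[of g B, OF B(2), of \<omega> k \<theta>] by linarith
    moreover have "2 * (real k * B) \<le> 2 * (real K * B)"
      using k(1) B(1) by simp
    moreover have "2 * (real K * B) \<le> e / 2 * real n"
    proof -
      have "2 * real K * B / (e / 2) < real n"
        using n\<^sub>0 n by (meson less_le_trans of_nat_le_iff)
      then show ?thesis
        using \<open>e > 0\<close> by (simp add: field_simps)
    qed
    ultimately show "\<bar>birkhoff \<omega> g n \<theta> - birkhoff \<omega> g n \<theta>'\<bar> \<le> e * real n"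
      using 1 by linarith
  qed
qed

section \<open>Rotation numbers\<close>

text \<open>The fibre maps of a lift of degree one.  Composition preserves the three conditions, so an
  estimate that uses only them holds for all iterates with the same constants.\<close>

definition fibre_lift :: "(circle \<Rightarrow> real \<Rightarrow> real) \<Rightarrow> bool" where
  "fibre_lift G \<longleftrightarrow> continuous_on UNIV (\<lambda>z. G (fst z) (snd z)) \<and>
     (\<forall>\<theta>. mono (G \<theta>)) \<and> (\<forall>\<theta> w. G \<theta> (w + 1) = G \<theta> w + 1)"

primrec orbit :: "circle \<Rightarrow> (circle \<Rightarrow> real \<Rightarrow> real) \<Rightarrow> nat \<Rightarrow> circle \<Rightarrow> real \<Rightarrow> real" where
  "orbit \<omega> G 0 \<theta> w = w"
| "orbit \<omega> G (Suc n) \<theta> w = G (\<theta> + n \<cdot> \<omega>) (orbit \<omega> G n \<theta> w)"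

lemma orbit_add: "orbit \<omega> G (m + n) \<theta> w = orbit \<omega> G m (\<theta> + n \<cdot> \<omega>) (orbit \<omega> G n \<theta> w)"
  by (induction m) (simp_all add: nmul_add algebra_simps)

lemma funpow_skew_product:
  "((\<lambda>(\<theta>, w). (\<theta> + \<omega>, G \<theta> w)) ^^ n) (\<theta>, w) = (\<theta> + n \<cdot> \<omega>, orbit \<omega> G n \<theta> w)"
  by (induction n) (simp_all add: algebra_simps)

lemma fibre_lift_continuous:
  assumes "fibre_lift G" "continuous_on S f" "continuous_on S h"
  shows "continuous_on S (\<lambda>x. G (f x) (h x))"
proof -
  have "continuous_on S (\<lambda>x. (f x, h x))"
    using assms by (intro continuous_intros)
  from continuous_on_compose2[OF _ this, of UNIV "\<lambda>z. G (fst z) (snd z)"] show ?thesis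
    using assms(1) unfolding fibre_lift_def by simp
qed

lemma fibre_lift_mono: "fibre_lift G \<Longrightarrow> x \<le> y \<Longrightarrow> G \<theta> x \<le> G \<theta> y"
  unfolding fibre_lift_def by (meson monoD)

lemma fibre_lift_add_int:
  assumes "fibre_lift G"
  shows "G \<theta> (w + of_int k) = G \<theta> w + of_int k"
proof -
  have nat: "G \<theta> (v + real n) = G \<theta> v + real n" for v n
  proof (induction n)
    case (Suc n)
    have "G \<theta> (v + real (Suc n)) = G \<theta> (v + real n + 1)"
      by (simp add: algebra_simps)
    also have "\<dots> = G \<theta> (v + real n) + 1"
      using assms unfolding fibre_lift_def by blast
    finally show ?case using Suc by simp
  qed simp
  show ?thesis
  proof (cases "k \<ge> 0")
    case True
    then show ?thesis using nat[of w "nat k"] by simp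
  next
    case False
    then show ?thesis using nat[of "w + of_int k" "nat (- k)"] by simp
  qed
qed

text \<open>All points of a fibre are displaced by the same amount up to \<open>1\<close>: translate \<open>w\<close> into the unit
  interval by an integer and use monotonicity there.\<close>

lemma fibre_lift_displacement:
  assumes "fibre_lift G"
  shows "\<bar>G \<theta> w - w - G \<theta> 0\<bar> \<le> 1"
proof -
  have "G \<theta> (of_int \<lfloor>w\<rfloor>) \<le> G \<theta> w" "G \<theta> w \<le> G \<theta> (of_int (\<lfloor>w\<rfloor> + 1))"
    by (intro fibre_lift_mono[OF assms]; linarith)+
  moreover have "G \<theta> (of_int k) = G \<theta> 0 + of_int k" for k
    using fibre_lift_add_int[OF assms, of \<theta> 0 k] by simp
  ultimately have "G \<theta> 0 + of_int \<lfloor>w\<rfloor> \<le> G \<theta> w" "G \<theta> w \<le> G \<theta> 0 + of_int \<lfloor>w\<rfloor> + 1"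
    by (metis of_int_1 of_int_add add.assoc)+
  then show ?thesis
    unfolding abs_le_iff by linarith
qed

lemma fibre_lift_orbit:
  assumes "fibre_lift G"
  shows "fibre_lift (orbit \<omega> G n)"
proof -
  have "continuous_on UNIV (\<lambda>z. orbit \<omega> G n (fst z) (snd z))"
    by (induction n) (auto intro!: continuous_intros fibre_lift_continuous[OF assms])
  moreover have "orbit \<omega> G n \<theta> x \<le> orbit \<omega> G n \<theta> y" if "x \<le> y" for \<theta> x y
    using that by (induction n) (auto intro!: fibre_lift_mono[OF assms])
  moreover have "orbit \<omega> G n \<theta> (w + 1) = orbit \<omega> G n \<theta> w + 1" for \<theta> w
    using fibre_lift_add_int[OF assms, of _ _ 1] by (induction n) auto
  ultimately show ?thesis
    unfolding fibre_lift_def by (auto intro: monoI)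
qed

text \<open>The convergence is uniform in the base point; this uniformity is what turns the sign of a rotation
  number into a drift of whole curves.  By bounded displacement the height \<open>0\<close> represents all others.\<close>

definition has_rotation :: "circle \<Rightarrow> (circle \<Rightarrow> real \<Rightarrow> real) \<Rightarrow> real \<Rightarrow> bool" where
  "has_rotation \<omega> G \<rho> \<longleftrightarrow>
     (\<forall>e>0. \<exists>n\<^sub>0. \<forall>n\<ge>n\<^sub>0. \<forall>\<theta>. \<bar>orbit \<omega> G n \<theta> 0 - real n * \<rho>\<bar> \<le> e * real n)"

lemma has_rotation_LIMSEQ:
  assumes G: "fibre_lift G" and rot: "has_rotation \<omega> G \<rho>"
  shows "(\<lambda>n. orbit \<omega> G n \<theta> w / real n) \<longlonglongrightarrow> \<rho>"
proof (rule LIMSEQ_I)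
  fix r :: real assume "r > 0"
  then obtain n\<^sub>0 where n\<^sub>0: "\<And>n. n \<ge> n\<^sub>0 \<Longrightarrow> \<bar>orbit \<omega> G n \<theta> 0 - real n * \<rho>\<bar> \<le> r / 2 * real n"
    using rot unfolding has_rotation_def by (metis half_gt_zero)
  obtain n\<^sub>1 where n\<^sub>1: "real n\<^sub>1 > (\<bar>w\<bar> + 1) / (r / 2)"
    using reals_Archimedean2 by blast
  show "\<exists>N. \<forall>n\<ge>N. norm (orbit \<omega> G n \<theta> w / real n - \<rho>) < r"
  proof (intro exI allI impI)
    fix n assume n: "n \<ge> max n\<^sub>0 (Suc n\<^sub>1)"
    have "\<bar>w\<bar> + 1 < r / 2 * real n"
    proof -
      have "(\<bar>w\<bar> + 1) / (r / 2) < real n"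
        using n\<^sub>1 n by (simp add: order_less_le_trans)
      then show ?thesis using \<open>r > 0\<close> by (simp add: field_simps)
    qed
    moreover have "\<bar>orbit \<omega> G n \<theta> w - w - orbit \<omega> G n \<theta> 0\<bar> \<le> 1"
      by (rule fibre_lift_displacement[OF fibre_lift_orbit[OF G]])
    moreover have "\<bar>orbit \<omega> G n \<theta> 0 - real n * \<rho>\<bar> \<le> r / 2 * real n"
      using n\<^sub>0 n by simp
    ultimately have "\<bar>orbit \<omega> G n \<theta> w - real n * \<rho>\<bar> < r * real n"
      unfolding abs_le_iff abs_less_iff by (simp add: field_simps) linarith
    moreover have "n > 0" using n by simp
    ultimately show "norm (orbit \<omega> G n \<theta> w / real n - \<rho>) < r"
      by (simp add: field_simps abs_less_iff)
  qed
qed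

lemma has_rotation_mono:
  assumes "fibre_lift G" "fibre_lift H" "has_rotation \<omega> G \<rho>" "has_rotation \<omega> H \<sigma>"
    and le: "\<And>\<theta> w. G \<theta> w \<le> H \<theta> w"
  shows "\<rho> \<le> \<sigma>"
proof (rule LIMSEQ_le)
  show "(\<lambda>n. orbit \<omega> G n 0 0 / real n) \<longlonglongrightarrow> \<rho>" "(\<lambda>n. orbit \<omega> H n 0 0 / real n) \<longlonglongrightarrow> \<sigma>"
    by (rule has_rotation_LIMSEQ; fact)+
  have "orbit \<omega> G n 0 0 \<le> orbit \<omega> H n 0 0" for n
  proof (induction n)
    case (Suc n)
    then show ?case
      using fibre_lift_mono[OF assms(1) Suc] le order_trans by fastforce
  qed simp
  then show "\<exists>N. \<forall>n\<ge>N. orbit \<omega> G n 0 0 / real n \<le> orbit \<omega> H n 0 0 / real n"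
    by (auto intro!: divide_right_mono)
qed

context irrational_rotation
begin

text \<open>The functions \<open>D n\<close> need not be equicontinuous, so the comparison of nearby orbits cannot be applied
  to them directly.  But \<open>D N (\<theta> + i \<cdot> \<omega>)\<close> is \<open>D (N + i) \<theta> - D i \<theta>\<close> up to \<open>1\<close>, and summing over \<open>i < n\<close>
  telescopes: \<open>N\<close> times \<open>D n\<close> is the Birkhoff sum of the single function \<open>D N\<close> up to \<open>n\<close> plus a constant
  depending on \<open>N\<close>.  Dividing by a large \<open>N\<close> makes the error small compared with \<open>n\<close>.\<close>

lemma almost_additive_oscillation:
  assumes cont: "\<And>n. continuous_on UNIV (D n)"
    and add: "\<And>m n \<theta>. \<bar>D (m + n) \<theta> - D n \<theta> - D m (\<theta> + n \<cdot> \<omega>)\<bar> \<le> 1"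
    and "e > 0"
  obtains n\<^sub>0 where "\<And>n \<theta> \<theta>'. n \<ge> n\<^sub>0 \<Longrightarrow> \<bar>D n \<theta> - D n \<theta>'\<bar> \<le> e * real n"
proof -
  obtain N where N: "real N > 4 / e" using reals_Archimedean2 by blast
  then have "N > 0" using \<open>e > 0\<close> by (intro Nat.gr0I) simp
  define T where "T \<theta> = (\<Sum>j<N. D j \<theta>)" for \<theta>
  have "continuous_on UNIV T"
    unfolding T_def by (intro continuous_intros cont)
  then obtain B where B: "B > 0" "\<And>\<theta>. \<bar>T \<theta>\<bar> \<le> B"
    using circle_bounded by blast
  have approx: "\<bar>real N * D n \<theta> - birkhoff \<omega> (D N) n \<theta>\<bar> \<le> real n + real N + 2 * B" for n \<theta>
  proof -
    have 1: "\<bar>birkhoff \<omega> (D N) n \<theta> - (\<Sum>i<n. D (N + i) \<theta> - D i \<theta>)\<bar> \<le> real n"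
    proof -
      have "\<bar>birkhoff \<omega> (D N) n \<theta> - (\<Sum>i<n. D (N + i) \<theta> - D i \<theta>)\<bar>
          \<le> (\<Sum>i<n. \<bar>D N (\<theta> + i \<cdot> \<omega>) - (D (N + i) \<theta> - D i \<theta>)\<bar>)"
        unfolding birkhoff_def sum_subtractf[symmetric] by (rule sum_abs)
      also have "\<dots> \<le> (\<Sum>i<n. 1)"
      proof (rule sum_mono)
        fix i
        show "\<bar>D N (\<theta> + i \<cdot> \<omega>) - (D (N + i) \<theta> - D i \<theta>)\<bar> \<le> 1"
          using add[of N i \<theta>] by (simp add: abs_le_iff)
      qed
      finally show ?thesis by simp
    qed
    have 2: "(\<Sum>i<n. D (N + i) \<theta> - D i \<theta>) = (\<Sum>j<N. D (j + n) \<theta>) - T \<theta>"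
    proof (induction n)
      case 0
      then show ?case by (simp add: T_def)
    next
      case (Suc n)
      have "(\<Sum>j<N. D (j + Suc n) \<theta>) = (\<Sum>j<Suc N. D (j + n) \<theta>) - D n \<theta>"
        by (subst sum.lessThan_Suc_shift) simp
      also have "\<dots> = (\<Sum>j<N. D (j + n) \<theta>) + D (N + n) \<theta> - D n \<theta>"
        by simp
      finally show ?case using Suc by simp
    qed
    have 3: "\<bar>(\<Sum>j<N. D (j + n) \<theta>) - (real N * D n \<theta> + T (\<theta> + n \<cdot> \<omega>))\<bar> \<le> real N"
    proof -
      have "(\<Sum>j<N. D (j + n) \<theta>) - (real N * D n \<theta> + T (\<theta> + n \<cdot> \<omega>))
          = (\<Sum>j<N. D (j + n) \<theta> - D n \<theta> - D j (\<theta> + n \<cdot> \<omega>))"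
        by (simp add: sum_subtractf T_def)
      also have "\<bar>\<dots>\<bar> \<le> (\<Sum>j<N. \<bar>D (j + n) \<theta> - D n \<theta> - D j (\<theta> + n \<cdot> \<omega>)\<bar>)"
        by (rule sum_abs)
      also have "\<dots> \<le> (\<Sum>j<N. 1)"
        by (intro sum_mono add)
      finally show ?thesis by simp
    qed
    show ?thesis
      using 1 2 3 B(2)[of \<theta>] B(2)[of "\<theta> + n \<cdot> \<omega>"] unfolding abs_le_iff by linarith
  qed
  obtain n\<^sub>1 where n\<^sub>1: "\<And>n \<theta> \<theta>'. n \<ge> n\<^sub>1 \<Longrightarrow>
      \<bar>birkhoff \<omega> (D N) n \<theta> - birkhoff \<omega> (D N) n \<theta>'\<bar> \<le> 1 * real n"
    using birkhoff_oscillation[OF cont[of N], of 1] by auto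
  obtain n\<^sub>2 where n\<^sub>2: "real n\<^sub>2 > 2 * (real N + 2 * B)" using reals_Archimedean2 by blast
  show ?thesis
  proof
    fix n \<theta> \<theta>' assume n: "n \<ge> max n\<^sub>1 n\<^sub>2"
    have "real n \<ge> 2 * (real N + 2 * B)"
      using n\<^sub>2 n by (smt (verit) max.bounded_iff of_nat_le_iff)
    moreover have "\<bar>birkhoff \<omega> (D N) n \<theta> - birkhoff \<omega> (D N) n \<theta>'\<bar> \<le> real n"
      using n\<^sub>1[of n \<theta> \<theta>'] n by simp
    moreover have "\<bar>x - y\<bar> \<le> 4 * c"
      if "2 * d \<le> c" "\<bar>s - t\<bar> \<le> c" "\<bar>x - s\<bar> \<le> c + d" "\<bar>y - t\<bar> \<le> c + d" for x y s t c d :: real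
      using that by linarith
    ultimately have "\<bar>real N * D n \<theta> - real N * D n \<theta>'\<bar> \<le> 4 * real n"
      using approx[of n \<theta>] approx[of n \<theta>'] unfolding add.assoc by blast
    then have "real N * \<bar>D n \<theta> - D n \<theta>'\<bar> \<le> 4 * real n"
      by (simp add: abs_mult flip: right_diff_distrib)
    also have "\<dots> \<le> (real N * e) * real n"
      using N \<open>e > 0\<close> by (intro mult_right_mono) (auto simp: field_simps)
    finally have "real N * \<bar>D n \<theta> - D n \<theta>'\<bar> \<le> real N * (e * real n)"
      by (simp add: mult.assoc)
    then show "\<bar>D n \<theta> - D n \<theta>'\<bar> \<le> e * real n"
      using \<open>N > 0\<close> by simp
  qed
qed

text \<open>Since \<open>D n\<close> oscillates by \<open>o(n)\<close>, cutting \<open>m n\<close> steps into \<open>m\<close> blocks gives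
  \<open>D (m * n) 0 = m (D n 0 + o(n))\<close>.  Comparing the averages over \<open>m\<close> and over \<open>n\<close> steps with the one
  over \<open>m n\<close> steps shows that the averages form a Cauchy sequence.\<close>

lemma almost_additive_average:
  assumes cont: "\<And>n. continuous_on UNIV (D n)"
    and add: "\<And>m n \<theta>. \<bar>D (m + n) \<theta> - D n \<theta> - D m (\<theta> + n \<cdot> \<omega>)\<bar> \<le> 1"
  obtains \<rho> where "\<And>e. e > 0 \<Longrightarrow> \<exists>n\<^sub>0. \<forall>n\<ge>n\<^sub>0. \<forall>\<theta>. \<bar>D n \<theta> - real n * \<rho>\<bar> \<le> e * real n"
proof -
  have osc: "\<exists>n\<^sub>0. \<forall>n\<ge>n\<^sub>0. \<forall>\<theta> \<theta>'. \<bar>D n \<theta> - D n \<theta>'\<bar> \<le> e * real n" if "e > 0" for e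
    using almost_additive_oscillation[OF assms that] by metis
  define a where "a n = D n 0 / real n" for n
  have mult: "\<bar>D (m * n) \<theta> - real m * D n 0\<bar> \<le> real m * (1 + c) + 1"
    if c: "\<And>\<theta> \<theta>'. \<bar>D n \<theta> - D n \<theta>'\<bar> \<le> c" for m n c \<theta>
  proof (induction m arbitrary: \<theta>)
    case 0
    show ?case using add[of 0 0 \<theta>] by simp
  next
    case (Suc m)
    have "\<bar>D (n + m * n) \<theta> - D (m * n) \<theta> - D n (\<theta> + (m * n) \<cdot> \<omega>)\<bar> \<le> 1"
      by (rule add)
    then have "\<bar>D (Suc m * n) \<theta> - real (Suc m) * D n 0\<bar>
        \<le> \<bar>D (m * n) \<theta> - real m * D n 0\<bar> + 1 + \<bar>D n (\<theta> + (m * n) \<cdot> \<omega>) - D n 0\<bar>"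
      by (simp add: algebra_simps)
    also have "\<dots> \<le> real m * (1 + c) + 1 + 1 + c"
      using Suc[of \<theta>] c[of "\<theta> + (m * n) \<cdot> \<omega>" 0] by linarith
    finally show ?case by (simp add: algebra_simps)
  qed
  have near: "\<exists>n\<^sub>0>0. \<forall>n\<ge>n\<^sub>0. \<forall>m>0. \<bar>a (m * n) - a n\<bar> \<le> e" if e: "e > 0" for e
  proof -
    obtain n\<^sub>1 where n\<^sub>1: "\<forall>n\<ge>n\<^sub>1. \<forall>\<theta> \<theta>'. \<bar>D n \<theta> - D n \<theta>'\<bar> \<le> e / 2 * real n"
      using osc[OF half_gt_zero[OF e]] by (elim exE)
    obtain n\<^sub>2 where n\<^sub>2: "real n\<^sub>2 > 4 / e" using reals_Archimedean2 by blast
    show ?thesis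
    proof (intro exI[of _ "max n\<^sub>1 (Suc n\<^sub>2)"] conjI allI impI)
      fix m n :: nat assume n: "n \<ge> max n\<^sub>1 (Suc n\<^sub>2)" and m: "m > 0"
      have "4 / e < real n"
        using n\<^sub>2 n by (simp add: order_less_le_trans)
      then have 2: "2 \<le> e / 2 * real n"
        using e by (simp add: field_simps)
      have "\<bar>D (m * n) 0 - real m * D n 0\<bar> \<le> real m * (1 + e / 2 * real n) + 1"
        using n\<^sub>1 n by (intro mult) auto
      also have "\<dots> \<le> real m * (2 + e / 2 * real n)"
        using m by (simp add: algebra_simps)
      also have "\<dots> \<le> real m * (e * real n)"
        using 2 by (intro mult_left_mono) auto
      finally have "\<bar>D (m * n) 0 - real m * D n 0\<bar> \<le> e * (real m * real n)"
        by (simp add: algebra_simps)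
      moreover have "a (m * n) - a n = (D (m * n) 0 - real m * D n 0) / (real m * real n)"
        using m n by (simp add: a_def field_simps)
      ultimately show "\<bar>a (m * n) - a n\<bar> \<le> e"
        using m n by (simp add: pos_divide_le_eq)
    qed simp
  qed
  have "Cauchy a"
  proof (rule metric_CauchyI)
    fix e :: real assume "e > 0"
    then obtain n\<^sub>0 where n\<^sub>0: "n\<^sub>0 > 0" "\<forall>n\<ge>n\<^sub>0. \<forall>m>0. \<bar>a (m * n) - a n\<bar> \<le> e / 3"
      using near[of "e / 3"] by auto
    have "dist (a m) (a n) < e" if "m \<ge> n\<^sub>0" "n \<ge> n\<^sub>0" for m n
    proof -
      have "\<bar>a (m * n) - a n\<bar> \<le> e / 3" "\<bar>a (m * n) - a m\<bar> \<le> e / 3"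
        using n\<^sub>0 that by (metis mult.commute order_less_le_trans)+
      then show ?thesis using \<open>e > 0\<close> unfolding dist_real_def by linarith
    qed
    then show "\<exists>M. \<forall>m\<ge>M. \<forall>n\<ge>M. dist (a m) (a n) < e" by blast
  qed
  then obtain \<rho> where \<rho>: "a \<longlonglongrightarrow> \<rho>"
    using Cauchy_convergent convergentD by blast
  show ?thesis
  proof
    fix e :: real assume "e > 0"
    obtain n\<^sub>1 where n\<^sub>1: "\<forall>n\<ge>n\<^sub>1. \<forall>\<theta> \<theta>'. \<bar>D n \<theta> - D n \<theta>'\<bar> \<le> e / 2 * real n"
      using osc[OF half_gt_zero[OF \<open>e > 0\<close>]] by (elim exE)
    obtain n\<^sub>2 where n\<^sub>2: "\<forall>n\<ge>n\<^sub>2. \<bar>a n - \<rho>\<bar> < e / 2"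
      using LIMSEQ_D[OF \<rho> half_gt_zero[OF \<open>e > 0\<close>]] unfolding real_norm_def by (elim exE)
    have "\<bar>D n \<theta> - real n * \<rho>\<bar> \<le> e * real n" if "n \<ge> max n\<^sub>1 (Suc n\<^sub>2)" for n \<theta>
    proof -
      have "\<bar>D n \<theta> - D n 0\<bar> \<le> e / 2 * real n"
        using n\<^sub>1 that by simp
      moreover have "\<bar>D n 0 - real n * \<rho>\<bar> \<le> e / 2 * real n"
      proof -
        have "D n 0 - real n * \<rho> = (a n - \<rho>) * real n"
          using that by (simp add: a_def field_simps)
        moreover have "\<bar>a n - \<rho>\<bar> \<le> e / 2"
          using n\<^sub>2 that by (simp add: less_imp_le)
        ultimately show ?thesis
          using mult_right_mono[of "\<bar>a n - \<rho>\<bar>" "e / 2" "real n"] by (simp add: abs_mult)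
      qed
      ultimately show ?thesis by (unfold abs_le_iff) linarith
    qed
    then show "\<exists>n\<^sub>0. \<forall>n\<ge>n\<^sub>0. \<forall>\<theta>. \<bar>D n \<theta> - real n * \<rho>\<bar> \<le> e * real n" by blast
  qed
qed

lemma rotation_exists:
  assumes "fibre_lift G"
  obtains \<rho> where "has_rotation \<omega> G \<rho>"
proof -
  have "continuous_on UNIV (\<lambda>\<theta>. orbit \<omega> G n \<theta> 0)" for n
    by (intro fibre_lift_continuous[OF fibre_lift_orbit[OF assms]] continuous_intros)
  moreover have "\<bar>orbit \<omega> G (m + n) \<theta> 0 - orbit \<omega> G n \<theta> 0 - orbit \<omega> G m (\<theta> + n \<cdot> \<omega>) 0\<bar> \<le> 1"
    for m n \<theta>
    unfolding orbit_add by (rule fibre_lift_displacement[OF fibre_lift_orbit[OF assms]])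
  ultimately obtain \<rho> where
    "\<And>e. e > 0 \<Longrightarrow> \<exists>n\<^sub>0. \<forall>n\<ge>n\<^sub>0. \<forall>\<theta>. \<bar>orbit \<omega> G n \<theta> 0 - real n * \<rho>\<bar> \<le> e * real n"
    using almost_additive_average[of "\<lambda>n \<theta>. orbit \<omega> G n \<theta> 0"] by blast
  then show ?thesis
    by (intro that[of \<rho>]) (simp add: has_rotation_def)
qed

end

section \<open>A criterion for mode-locking\<close>

lemma orbit_add_int:
  assumes "fibre_lift G"
  shows "orbit \<omega> (\<lambda>\<theta> w. G \<theta> w + of_int k) n \<theta> w = orbit \<omega> G n \<theta> w + real n * of_int k"
proof (induction n)
  case (Suc n)
  have "orbit \<omega> G n \<theta> w + real n * of_int k = orbit \<omega> G n \<theta> w + of_int (int n * k)"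
    by simp
  then show ?case
    using Suc fibre_lift_add_int[OF assms, of "\<theta> + n \<cdot> \<omega>" "orbit \<omega> G n \<theta> w" "int n * k"]
    by (simp add: ring_distribs)
qed simp

lemma has_rotation_add_int:
  assumes "fibre_lift G" "has_rotation \<omega> G \<rho>"
  shows "has_rotation \<omega> (\<lambda>\<theta> w. G \<theta> w + of_int k) (\<rho> + of_int k)"
  using assms(2) unfolding has_rotation_def orbit_add_int[OF assms(1)] by (simp add: algebra_simps)

lemma fibre_lift_homeomorphism:
  assumes G: "fibre_lift G" and "strict_mono (G \<theta>)"
  shows "\<exists>h. homeomorphism UNIV UNIV (G \<theta>) h"
proof -
  have cont: "continuous_on UNIV (G \<theta>)"
    using fibre_lift_continuous[OF G, of UNIV "\<lambda>_. \<theta>" "\<lambda>w. w"] by (simp add: continuous_intros)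
  have "\<exists>x. G \<theta> x = y" for y
  proof -
    define k where "k = \<lfloor>y - G \<theta> 0\<rfloor>"
    have "G \<theta> (of_int k) = G \<theta> 0 + of_int k" "G \<theta> (of_int (k + 1)) = G \<theta> 0 + of_int (k + 1)"
      using fibre_lift_add_int[OF G, of \<theta> 0 k] fibre_lift_add_int[OF G, of \<theta> 0 "k + 1"] by simp_all
    then have "G \<theta> (of_int k) \<le> y" "y \<le> G \<theta> (of_int (k + 1))"
      unfolding k_def by linarith+
    then show ?thesis
      using IVT'[of "G \<theta>" "of_int k" y "of_int (k + 1)"] continuous_on_subset[OF cont] by auto
  qed
  then have "surj (G \<theta>)" by (metis surjI)
  moreover have "inj (G \<theta>)" using assms(2) by (rule strict_mono_imp_inj_on)
  ultimately show ?thesis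
    using injective_into_1d_eq_homeomorphism[OF cont] by (simp add: convex_imp_path_connected)
qed

text \<open>A continuous function that stays within \<open>1 / 2\<close> of the integers omits the half-integers, so on a
  connected space it cannot pass from one integer to another.\<close>

lemma near_integer_const:
  fixes e :: "'a::topological_space \<Rightarrow> real"
  assumes "connected (UNIV :: 'a set)" "continuous_on UNIV e" "\<delta> \<le> 1 / 2"
    and near: "\<And>z. \<exists>k :: int. \<bar>e z - of_int k\<bar> < \<delta>"
  obtains k :: int where "\<And>z. \<bar>e z - of_int k\<bar> < \<delta>"
proof -
  have "connected (range e)"
    using assms by (intro connected_continuous_image)
  then have between: "\<exists>z. e z = c" if "e x \<le> c" "c \<le> e y" for x y c
    using that connected_contains_Icc[of "range e" "e x" "e y"] by fastforce
  have not_half: "e z \<noteq> of_int k + 1 / 2" for z k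
  proof
    assume "e z = of_int k + 1 / 2"
    moreover obtain j :: int where "\<bar>e z - of_int j\<bar> < \<delta>" using near by blast
    ultimately have "of_int j < (of_int (k + 1) :: real)" "of_int k < (of_int j :: real)"
      using \<open>\<delta> \<le> 1 / 2\<close> unfolding of_int_add by linarith+
    then have "j < k + 1" "k < j" by (simp_all only: of_int_less_iff)
    then show False by simp
  qed
  fix x
  obtain k :: int where k: "\<bar>e x - of_int k\<bar> < \<delta>" using near by blast
  have "\<bar>e y - of_int k\<bar> < \<delta>" for y
  proof -
    obtain j :: int where j: "\<bar>e y - of_int j\<bar> < \<delta>" using near by blast
    have "\<not> j < k"
    proof
      assume "j < k"
      then have "of_int j \<le> (of_int k - 1 :: real)"
        by (metis of_int_1 of_int_diff of_int_le_iff zle_diff1_eq)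
      then have "e y \<le> of_int k - 1 / 2" "of_int k - 1 / 2 \<le> e x"
        using j k \<open>\<delta> \<le> 1 / 2\<close> by linarith+
      then obtain z where "e z = of_int k - 1 / 2" using between by blast
      then show False using not_half[of z "k - 1"] by simp
    qed
    moreover have "\<not> k < j"
    proof
      assume "k < j"
      then have "of_int k \<le> (of_int j - 1 :: real)"
        by (metis of_int_1 of_int_diff of_int_le_iff zle_diff1_eq)
      then have "e x \<le> of_int k + 1 / 2" "of_int k + 1 / 2 \<le> e y"
        using j k \<open>\<delta> \<le> 1 / 2\<close> by linarith+
      then show False using between not_half by blast
    qed
    ultimately show ?thesis using j by simp
  qed
  then show ?thesis by (rule that)
qed

lemma connected_circle: "connected (UNIV :: circle set)"
proof -
  have "UNIV = range to_circle"
    by (metis UNIV_eq_I rangeI to_circle_cases)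
  then show ?thesis
    by (metis connected_continuous_image continuous_on_to_circle connected_UNIV)
qed

text \<open>That the degree is one comes from the injectivity of \<open>f\<close>: some \<open>v\<close> in the interval from \<open>w\<close> to
  \<open>w + 1\<close> satisfies \<open>G \<theta> v = G \<theta> w + 1\<close> and hence represents the same point of the circle as \<open>w\<close>,
  which leaves only \<open>v = w + 1\<close>.\<close>

lemma forced_lift_fibre:
  assumes homeo: "forced_circle_homeo \<omega> f" and F: "forced_lift \<omega> f F"
  defines "G \<equiv> \<lambda>\<theta> w. snd (F (\<theta>, w))"
  shows "F = (\<lambda>(\<theta>, w). (\<theta> + \<omega>, G \<theta> w))"
    and "\<And>\<theta> w. f (\<theta>, to_circle w) = (\<theta> + \<omega>, to_circle (G \<theta> w))"
    and "fibre_lift G"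
proof -
  show F_eq: "F = (\<lambda>(\<theta>, w). (\<theta> + \<omega>, G \<theta> w))"
    using F unfolding forced_lift_def G_def by (auto simp: prod_eq_iff)
  have "(map_prod id to_circle \<circ> F) (\<theta>, w) = (f \<circ> map_prod id to_circle) (\<theta>, w)" for \<theta> w
    using F unfolding forced_lift_def by presburger
  then show semi: "f (\<theta>, to_circle w) = (\<theta> + \<omega>, to_circle (G \<theta> w))" for \<theta> w
    by (simp add: F_eq)
  have "continuous_on UNIV F"
    using F unfolding forced_lift_def homeomorphism_def by blast
  then have cont: "continuous_on UNIV (\<lambda>z. G (fst z) (snd z))"
    unfolding G_def by (auto intro!: continuous_intros)
  have mono: "strict_mono (G \<theta>)" for \<theta>
    using F unfolding forced_lift_def G_def by blast
  have inj: "inj f"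
    using homeo unfolding forced_circle_homeo_def homeomorphism_def by (metis UNIV_I injI)
  have "G \<theta> (w + 1) = G \<theta> w + 1" for \<theta> w
  proof -
    have "to_circle (G \<theta> (w + 1)) = to_circle (G \<theta> w)"
      using semi[of \<theta> "w + 1"] semi[of \<theta> w] by (simp add: to_circle_add)
    then obtain k :: int where k: "G \<theta> (w + 1) = G \<theta> w + of_int k"
      unfolding to_circle_eq_iff by blast
    have "G \<theta> w < G \<theta> (w + 1)"
      using mono by (simp add: strict_mono_less)
    then have "k \<ge> 1" using k by simp
    then have "G \<theta> w + 1 \<le> G \<theta> (w + 1)" using k by simp
    moreover have "continuous_on {w..w + 1} (G \<theta>)"
      by (rule continuous_on_compose2[OF cont, of _ "\<lambda>w. (\<theta>, w)", simplified])
        (auto intro!: continuous_intros)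
    ultimately obtain v where v: "w \<le> v" "v \<le> w + 1" "G \<theta> v = G \<theta> w + 1"
      using IVT'[of "G \<theta>" w "G \<theta> w + 1" "w + 1"] by auto
    have "f (\<theta>, to_circle v) = f (\<theta>, to_circle w)"
      by (simp add: semi v(3) to_circle_add)
    then have "to_circle v = to_circle w" using inj by (simp add: inj_eq)
    then obtain j :: int where j: "v = w + of_int j" unfolding to_circle_eq_iff by blast
    have "j \<noteq> 0" using j v by auto
    then have "v = w + 1" using j v by simp
    then show ?thesis using v(3) by simp
  qed
  then show "fibre_lift G"
    unfolding fibre_lift_def using cont mono by (simp add: strict_mono_mono)
qed

lemma lift_rotation_number_eq:
  assumes "fibre_lift G" "has_rotation \<omega> G \<rho>"
  shows "lift_rotation_number (\<lambda>(\<theta>, w). (\<theta> + \<omega>, G \<theta> w)) = \<rho>"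
  unfolding lift_rotation_number_def funpow_skew_product
proof (rule the_equality)
  show "\<forall>\<theta> w. (\<lambda>n. snd (\<theta> + n \<cdot> \<omega>, orbit \<omega> G n \<theta> w) / real n) \<longlonglongrightarrow> \<rho>"
    using has_rotation_LIMSEQ[OF assms] by simp
next
  fix r assume "\<forall>\<theta> w. (\<lambda>n. snd (\<theta> + n \<cdot> \<omega>, orbit \<omega> G n \<theta> w) / real n) \<longlonglongrightarrow> r"
  then have "(\<lambda>n. orbit \<omega> G n 0 0 / real n) \<longlonglongrightarrow> r" by simp
  then show "r = \<rho>"
    using has_rotation_LIMSEQ[OF assms, of 0 0] LIMSEQ_unique by blast
qed

text \<open>All lifts of \<open>f\<close> are treated at once, so that the independence of \<open>rotation_number\<close> of the lift is
  part of the conclusion.\<close>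

lemma rotation_number_eq:
  assumes f: "forced_circle_homeo \<omega> f"
    and rot: "\<And>F. forced_lift \<omega> f F \<Longrightarrow>
      \<exists>k :: int. has_rotation \<omega> (\<lambda>\<theta> w. snd (F (\<theta>, w))) (\<rho> + of_int k)"
  shows "rotation_number \<omega> f = to_circle \<rho>"
proof -
  have *: "to_circle (lift_rotation_number F) = to_circle \<rho>" if F: "forced_lift \<omega> f F" for F
  proof -
    obtain k :: int where k: "has_rotation \<omega> (\<lambda>\<theta> w. snd (F (\<theta>, w))) (\<rho> + of_int k)"
      using rot[OF F] by blast
    have "lift_rotation_number F = \<rho> + of_int k"
      using lift_rotation_number_eq[OF forced_lift_fibre(3)[OF f F] k]
      by (simp flip: forced_lift_fibre(1)[OF f F])
    then show ?thesis by (simp add: to_circle_add)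
  qed
  moreover obtain F where "forced_lift \<omega> f F"
    using f unfolding forced_circle_homeo_def by blast
  ultimately show ?thesis
    unfolding rotation_number_def by (intro the_equality) auto
qed

text \<open>A lift of a map close to \<open>f\<close> is close to \<open>G\<close> up to one integer \<open>k\<close>, because the difference is close to
  the integers on a connected space.  It lies between the translates of \<open>L\<close> and \<open>U\<close> by \<open>k\<close>, and these
  have the common rotation number \<open>\<rho> + k\<close>.\<close>

lemma (in irrational_rotation) mode_lockedI:
  assumes f: "forced_circle_homeo \<omega> f"
    and G: "\<And>\<theta> w. f (\<theta>, to_circle w) = (\<theta> + \<omega>, to_circle (G \<theta> w))" "fibre_lift G"
    and lower: "fibre_lift L" "has_rotation \<omega> L \<rho>"
    and upper: "fibre_lift U" "has_rotation \<omega> U \<rho>"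
    and "\<epsilon> > 0" and gap: "\<And>\<theta> w. L \<theta> w \<le> G \<theta> w - \<epsilon>" "\<And>\<theta> w. G \<theta> w + \<epsilon> \<le> U \<theta> w"
  shows "mode_locked \<omega> f"
proof -
  define \<delta> where "\<delta> = min \<epsilon> (1 / 2)"
  have \<delta>: "\<delta> > 0" "\<delta> \<le> \<epsilon>" "\<delta> \<le> 1 / 2" using \<open>\<epsilon> > 0\<close> by (auto simp: \<delta>_def)
  have rot: "rotation_number \<omega> f' = to_circle \<rho>"
    if f': "forced_circle_homeo \<omega> f'" and close: "\<And>z. dist (f' z) (f z) < \<delta>" for f'
  proof (rule rotation_number_eq[OF f'])
    fix F assume F: "forced_lift \<omega> f' F"
    define G' where "G' = (\<lambda>\<theta> w. snd (F (\<theta>, w)))"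
    have G': "f' (\<theta>, to_circle w) = (\<theta> + \<omega>, to_circle (G' \<theta> w))" "fibre_lift G'" for \<theta> w
      using forced_lift_fibre[OF f' F] by (simp_all add: G'_def)
    have "\<exists>k :: int. \<bar>G' (fst z) (snd z) - G (fst z) (snd z) - of_int k\<bar> < \<delta>" for z
    proof -
      obtain \<theta> w where z: "z = (\<theta>, w)" by fastforce
      have "dist (to_circle (G' \<theta> w)) (to_circle (G \<theta> w)) < \<delta>"
        using close[of "(\<theta>, to_circle w)"] by (simp add: G G' dist_prod_def)
      then show ?thesis by (auto simp: dist_circle.abs_eq z)
    qed
    moreover have "connected (UNIV :: (circle \<times> real) set)"
      using connected_Times[OF connected_circle connected_UNIV] by simp
    moreover have "continuous_on UNIV (\<lambda>z. G' (fst z) (snd z) - G (fst z) (snd z))"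
      using G G' unfolding fibre_lift_def by (intro continuous_intros) auto
    ultimately obtain k :: int
      where k: "\<And>z. \<bar>G' (fst z) (snd z) - G (fst z) (snd z) - of_int k\<bar> < \<delta>"
      using near_integer_const[OF _ _ \<delta>(3), of "\<lambda>z. G' (fst z) (snd z) - G (fst z) (snd z)"] by blast
    have k': "\<bar>G' \<theta> w - G \<theta> w - of_int k\<bar> < \<delta>" for \<theta> w
      using k[of "(\<theta>, w)"] by simp
    obtain \<rho>' where \<rho>': "has_rotation \<omega> G' \<rho>'" by (rule rotation_exists[OF G'(2)])
    have shift: "fibre_lift (\<lambda>\<theta> w. H \<theta> w + of_int k)" if "fibre_lift H" for H
      using that unfolding fibre_lift_def mono_def by (auto intro!: continuous_intros)
    have "\<rho> + of_int k \<le> \<rho>'"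
      by (rule has_rotation_mono[OF shift[OF lower(1)] G'(2) has_rotation_add_int[OF lower] \<rho>'])
        (use k' gap \<delta> in \<open>smt (verit)\<close>)
    moreover have "\<rho>' \<le> \<rho> + of_int k"
      by (rule has_rotation_mono[OF G'(2) shift[OF upper(1)] \<rho>' has_rotation_add_int[OF upper]])
        (use k' gap \<delta> in \<open>smt (verit)\<close>)
    ultimately show "\<exists>k :: int. has_rotation \<omega> (\<lambda>\<theta> w. snd (F (\<theta>, w))) (\<rho> + of_int k)"
      using \<rho>' unfolding G'_def by (intro exI[of _ k]) simp
  qed
  have "rotation_number \<omega> f = to_circle \<rho>"
    using rot[OF f] \<delta> by simp
  with rot show ?thesis
    unfolding mode_locked_def using f \<delta>(1) by (intro conjI exI[of _ \<delta>]) auto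
qed

section \<open>The Arnold family\<close>

text \<open>For \<open>d = 0\<close> these are the fibre maps of the forced Arnold map with forcing \<open>\<phi>\<close>; for general \<open>d\<close>
  the same map is seen in the fibre coordinate \<open>w - d \<theta>\<close>, in which curves of degree \<open>d\<close> on the torus
  become graphs of real-valued functions.\<close>

definition arnold :: "real \<Rightarrow> nat \<Rightarrow> (circle \<Rightarrow> real) \<Rightarrow> circle \<Rightarrow> real \<Rightarrow> real" where
  "arnold \<alpha> d \<phi> \<theta> w = w + \<phi> \<theta> + \<alpha> / (2 * pi) * sin_circle (to_circle w + d \<cdot> \<theta>)"

lemma abs_sine_term_diff_le:
  assumes "\<alpha> \<ge> 0"
  shows "\<bar>\<alpha> / (2 * pi) * sin_circle (to_circle x + c) - \<alpha> / (2 * pi) * sin_circle (to_circle y + c)\<bar>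
    \<le> \<alpha> * \<bar>x - y\<bar>"
proof -
  have "\<bar>\<alpha> / (2 * pi) * sin_circle (to_circle x + c) - \<alpha> / (2 * pi) * sin_circle (to_circle y + c)\<bar>
      = \<alpha> / (2 * pi) * \<bar>sin_circle (to_circle x + c) - sin_circle (to_circle y + c)\<bar>"
    using assms unfolding right_diff_distrib[symmetric] abs_mult by simp
  also have "\<dots> \<le> \<alpha> / (2 * pi) * (2 * pi * \<bar>x - y\<bar>)"
    using assms by (intro mult_left_mono abs_sin_circle_diff_le) auto
  finally show ?thesis by simp
qed

lemma strict_mono_arnold:
  assumes "0 < \<alpha>" "\<alpha> < 1"
  shows "strict_mono (arnold \<alpha> d \<phi> \<theta>)"
proof (rule strict_monoI)
  fix x y :: real assume "x < y"
  have "\<alpha> * \<bar>x - y\<bar> < \<bar>x - y\<bar>" using assms \<open>x < y\<close> by simp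
  then show "arnold \<alpha> d \<phi> \<theta> x < arnold \<alpha> d \<phi> \<theta> y"
    unfolding arnold_def
    using abs_sine_term_diff_le[of \<alpha> x "d \<cdot> \<theta>" y] assms \<open>x < y\<close> by linarith
qed

lemma fibre_lift_arnold:
  assumes "0 < \<alpha>" "\<alpha> < 1" "continuous_on UNIV \<phi>"
  shows "fibre_lift (arnold \<alpha> d \<phi>)"
proof -
  have "continuous_on UNIV (\<lambda>z :: circle \<times> real. arnold \<alpha> d \<phi> (fst z) (snd z))"
    unfolding arnold_def
    by (intro continuous_intros continuous_on_compose2[OF assms(3)]) auto
  then show ?thesis
    unfolding fibre_lift_def
    using strict_mono_mono[OF strict_mono_arnold[OF assms(1,2)]]
    by (auto simp: arnold_def to_circle_add)
qed

lemma forced_arnold_map_to_circle: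
  "forced_arnold_map \<omega> \<alpha> \<beta> \<tau> q (\<theta>, to_circle w)
    = (\<theta> + \<omega>, to_circle (arnold \<alpha> 0 (\<lambda>\<theta>. \<tau> + \<beta> * q \<theta>) \<theta> w))"
  by (simp add: forced_arnold_map_def arnold_def algebra_simps flip: to_circle_add)

lemma forced_circle_homeo_arnold:
  assumes \<alpha>: "0 < \<alpha>" "\<alpha> < 1" and q: "continuous_on UNIV q"
  shows "forced_circle_homeo \<omega> (forced_arnold_map \<omega> \<alpha> \<beta> \<tau> q)"
proof -
  let ?f = "forced_arnold_map \<omega> \<alpha> \<beta> \<tau> q"
  define \<phi> where "\<phi> \<theta> = \<tau> + \<beta> * q \<theta>" for \<theta>
  have \<phi>: "continuous_on UNIV \<phi>"
    unfolding \<phi>_def by (intro continuous_intros q)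
  define G where "G = arnold \<alpha> 0 \<phi>"
  have G: "fibre_lift G" "\<And>\<theta>. strict_mono (G \<theta>)"
    unfolding G_def using fibre_lift_arnold strict_mono_arnold \<alpha> \<phi> by blast+
  have f: "?f (\<theta>, to_circle w) = (\<theta> + \<omega>, to_circle (G \<theta> w))" for \<theta> w
    unfolding G_def \<phi>_def by (rule forced_arnold_map_to_circle)
  (* The fibre maps are translates of a single homeomorphism H of the line, so one inverse h
     serves all fibres and the inverse of the lift is jointly continuous. *)
  define H where "H = arnold \<alpha> 0 (\<lambda>_. 0) 0"
  have "\<exists>h. homeomorphism UNIV UNIV H h"
    unfolding H_def
    by (intro fibre_lift_homeomorphism fibre_lift_arnold strict_mono_arnold \<alpha>) auto
  then obtain h where h: "\<And>w. h (H w) = w" "\<And>y. H (h y) = y" "continuous_on UNIV h"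
    unfolding homeomorphism_def by auto
  have GH: "G \<theta> w = H w + \<phi> \<theta>" for \<theta> w
    by (simp add: G_def H_def arnold_def)
  have "homeomorphism UNIV UNIV (\<lambda>(\<theta>, w). (\<theta> + \<omega>, G \<theta> w)) (\<lambda>(\<theta>, y). (\<theta> - \<omega>, h (y - \<phi> (\<theta> - \<omega>))))"
  proof (rule homeomorphismI)
    show "continuous_on UNIV (\<lambda>(\<theta>, w). (\<theta> + \<omega>, G \<theta> w))"
      unfolding case_prod_beta by (intro continuous_intros fibre_lift_continuous[OF G(1)])
    show "continuous_on UNIV (\<lambda>(\<theta>, y). (\<theta> - \<omega>, h (y - \<phi> (\<theta> - \<omega>))))"
      unfolding case_prod_beta
      by (intro continuous_intros continuous_on_compose2[OF h(3)] continuous_on_compose2[OF \<phi>]) auto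
  qed (auto simp: GH h)
  then have lift: "forced_lift \<omega> ?f (\<lambda>(\<theta>, w). (\<theta> + \<omega>, G \<theta> w))"
    unfolding forced_lift_def
    using G fibre_lift_homeomorphism[OF G] by (auto simp: fun_eq_iff f)
  have "continuous_on UNIV ?f"
    unfolding forced_arnold_map_def case_prod_beta
    by (intro continuous_intros continuous_on_compose2[OF q]) auto
  moreover have "inj ?f"
  proof (rule injI)
    fix a b assume eq: "?f a = ?f b"
    obtain \<theta> x where a: "a = (\<theta>, to_circle x)" by (metis surj_pair to_circle_cases)
    obtain \<eta> y where b: "b = (\<eta>, to_circle y)" by (metis surj_pair to_circle_cases)
    have "\<theta> = \<eta>" "to_circle (G \<theta> x) = to_circle (G \<theta> y)"
      using eq by (auto simp: a b f)
    then obtain k :: int where "G \<theta> x = G \<theta> y + of_int k"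
      unfolding to_circle_eq_iff by blast
    then have "G \<theta> x = G \<theta> (y + of_int k)"
      by (simp add: fibre_lift_add_int[OF G(1)])
    then have "x = y + of_int k"
      using G(2) by (simp add: strict_mono_eq)
    then show "a = b" using \<open>\<theta> = \<eta>\<close> by (simp add: a b to_circle_add)
  qed
  moreover have "surj ?f"
  proof (rule surjI)
    fix b :: "circle \<times> circle"
    obtain \<eta> y where b: "b = (\<eta>, to_circle y)" by (metis surj_pair to_circle_cases)
    show "?f ((\<lambda>(\<eta>, c). (\<eta> - \<omega>, to_circle (h ((SOME y. c = to_circle y) - \<phi> (\<eta> - \<omega>))))) b) = b"
      using someI[of "\<lambda>z. to_circle y = to_circle z" y] by (simp add: b f GH h)
  qed
  moreover have "compact (UNIV :: (circle \<times> circle) set)"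
    using compact_Times[OF compact_UNIV_circle compact_UNIV_circle] by simp
  ultimately have "\<exists>g. homeomorphism UNIV UNIV ?f g"
    by (intro homeomorphism_compact) auto
  with lift show ?thesis
    unfolding forced_circle_homeo_def by blast
qed

lemma (in irrational_rotation) arnold_mode_lockedI:
  assumes \<alpha>: "0 < \<alpha>" "\<alpha> < 1" and q: "continuous_on UNIV q" and "\<epsilon> > 0"
    and rot: "has_rotation \<omega> (arnold \<alpha> 0 (\<lambda>\<theta>. \<tau> + \<beta> * q \<theta> - \<epsilon>)) \<rho>"
      "has_rotation \<omega> (arnold \<alpha> 0 (\<lambda>\<theta>. \<tau> + \<beta> * q \<theta> + \<epsilon>)) \<rho>"
  shows "mode_locked \<omega> (forced_arnold_map \<omega> \<alpha> \<beta> \<tau> q)"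
proof (rule mode_lockedI[OF forced_circle_homeo_arnold[OF \<alpha> q] forced_arnold_map_to_circle _ _ rot(1) _ rot(2) \<open>\<epsilon> > 0\<close>])
  show "fibre_lift (arnold \<alpha> 0 (\<lambda>\<theta>. \<tau> + \<beta> * q \<theta>))"
    "fibre_lift (arnold \<alpha> 0 (\<lambda>\<theta>. \<tau> + \<beta> * q \<theta> - \<epsilon>))"
    "fibre_lift (arnold \<alpha> 0 (\<lambda>\<theta>. \<tau> + \<beta> * q \<theta> + \<epsilon>))"
    by (intro fibre_lift_arnold \<alpha> continuous_intros q)+
qed (simp_all add: arnold_def)

section \<open>Approximately invariant curves\<close>

text \<open>The graph transform: the skew product maps the graph of \<open>\<gamma>\<close> onto the graph of \<open>push \<omega> G \<gamma>\<close>.\<close>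

definition push :: "circle \<Rightarrow> (circle \<Rightarrow> real \<Rightarrow> real) \<Rightarrow> (circle \<Rightarrow> real) \<Rightarrow> circle \<Rightarrow> real" where
  "push \<omega> G \<gamma> \<theta> = G (\<theta> - \<omega>) (\<gamma> (\<theta> - \<omega>))"

lemma continuous_on_push:
  assumes "fibre_lift G" "continuous_on UNIV \<gamma>"
  shows "continuous_on UNIV (push \<omega> G \<gamma>)"
  unfolding push_def
  by (intro fibre_lift_continuous[OF assms(1)] continuous_on_compose2[OF assms(2)] continuous_intros) auto

lemma funpow_push: "(push \<omega> G ^^ n) \<gamma> (\<theta> + n \<cdot> \<omega>) = orbit \<omega> G n \<theta> (\<gamma> \<theta>)"
proof (induction n)
  case (Suc n)
  have "\<theta> + Suc n \<cdot> \<omega> - \<omega> = \<theta> + n \<cdot> \<omega>" by simp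
  then show ?case using Suc by (simp add: push_def)
qed simp

text \<open>Orbits starting on the curve move by \<open>n \<rho>\<close> with a sublinear error; for large \<open>n\<close> this outgrows the
  error and the oscillation of the curve.  The factor \<open>sgn \<rho>\<close> treats both directions of the drift.\<close>

lemma orbit_drift:
  assumes G: "fibre_lift G" and rot: "has_rotation \<omega> G \<rho>" and "\<rho> \<noteq> 0" and \<gamma>: "continuous_on UNIV \<gamma>"
  obtains n where "n > 0" "\<And>\<theta>. 0 \<le> sgn \<rho> * ((push \<omega> G ^^ n) \<gamma> \<theta> - \<gamma> \<theta>)"
proof -
  obtain B where B: "B > 0" "\<And>\<theta>. \<bar>\<gamma> \<theta>\<bar> \<le> B" using circle_bounded[OF \<gamma>] by blast
  have "\<bar>\<rho>\<bar> / 2 > 0" using \<open>\<rho> \<noteq> 0\<close> by simp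
  then obtain n\<^sub>0 where n\<^sub>0: "\<And>n \<theta>. n \<ge> n\<^sub>0 \<Longrightarrow> \<bar>orbit \<omega> G n \<theta> 0 - real n * \<rho>\<bar> \<le> \<bar>\<rho>\<bar> / 2 * real n"
    using rot unfolding has_rotation_def by meson
  obtain n\<^sub>1 where n\<^sub>1: "real n\<^sub>1 > (2 * B + 1) / (\<bar>\<rho>\<bar> / 2)" using reals_Archimedean2 by blast
  define n where "n = max n\<^sub>0 (Suc n\<^sub>1)"
  have "(2 * B + 1) / (\<bar>\<rho>\<bar> / 2) < real n"
    using n\<^sub>1 by (simp add: n_def)
  then have n: "2 * B + 1 < \<bar>\<rho>\<bar> / 2 * real n"
    using \<open>\<rho> \<noteq> 0\<close> by (simp add: field_simps)
  show ?thesis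
  proof
    show "n > 0" by (simp add: n_def)
    fix \<theta>
    define \<eta> where "\<eta> = \<theta> - n \<cdot> \<omega>"
    have "(push \<omega> G ^^ n) \<gamma> \<theta> = orbit \<omega> G n \<eta> (\<gamma> \<eta>)"
      using funpow_push[of n \<omega> G \<gamma> \<eta>] by (simp add: \<eta>_def)
    moreover have "\<bar>orbit \<omega> G n \<eta> (\<gamma> \<eta>) - \<gamma> \<eta> - orbit \<omega> G n \<eta> 0\<bar> \<le> 1"
      by (rule fibre_lift_displacement[OF fibre_lift_orbit[OF G]])
    moreover have "\<bar>orbit \<omega> G n \<eta> 0 - real n * \<rho>\<bar> \<le> \<bar>\<rho>\<bar> / 2 * real n"
      by (rule n\<^sub>0) (simp add: n_def)
    ultimately have *: "\<bar>(push \<omega> G ^^ n) \<gamma> \<theta> - \<gamma> \<theta> - real n * \<rho>\<bar> \<le> 2 * B + 1 + \<bar>\<rho>\<bar> / 2 * real n"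
      using B(2)[of \<theta>] B(2)[of \<eta>] by linarith
    show "0 \<le> sgn \<rho> * ((push \<omega> G ^^ n) \<gamma> \<theta> - \<gamma> \<theta>)"
    proof (cases "\<rho> > 0")
      case True
      have "real n * \<rho> = 2 * (\<bar>\<rho>\<bar> / 2 * real n)" using True by simp
      then have "0 \<le> (push \<omega> G ^^ n) \<gamma> \<theta> - \<gamma> \<theta>" using * n by linarith
      then show ?thesis using True by simp
    next
      case False
      then have "\<rho> < 0" using \<open>\<rho> \<noteq> 0\<close> by simp
      have "real n * \<rho> = - 2 * (\<bar>\<rho>\<bar> / 2 * real n)" using \<open>\<rho> < 0\<close> by simp
      then have "(push \<omega> G ^^ n) \<gamma> \<theta> - \<gamma> \<theta> \<le> 0" using * n by linarith
      then show ?thesis using \<open>\<rho> < 0\<close> by simp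
    qed
  qed
qed

text \<open>The operation \<open>m\<close> stands for the minimum or the maximum.  Starting from \<open>\<psi>\<close>, the \<open>k\<close>-th iterate of
  \<open>\<gamma> \<mapsto> m \<psi> (push \<omega> G \<gamma>)\<close> is the envelope of \<open>\<psi>\<close> and its first \<open>k\<close> images.  As \<open>\<psi>\<close> absorbs its \<open>n\<close>-th
  image, the envelope stops changing before step \<open>n\<close>; the limit is thus an envelope of finitely many
  curves, which makes it continuous.\<close>

lemma envelope_curve:
  fixes m :: "real \<Rightarrow> real \<Rightarrow> real"
  assumes assoc: "\<And>x y z. m (m x y) z = m x (m y z)" and comm: "\<And>x y. m x y = m y x"
    and distr: "\<And>h x y. mono h \<Longrightarrow> h (m x y) = m (h x) (h y)"
    and cont: "\<And>f g :: circle \<Rightarrow> real. continuous_on UNIV f \<Longrightarrow> continuous_on UNIV g \<Longrightarrow>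
      continuous_on UNIV (\<lambda>\<theta>. m (f \<theta>) (g \<theta>))"
    and G: "fibre_lift G" and \<psi>: "continuous_on UNIV \<psi>"
    and n: "n > 0" "\<And>\<theta>. m (\<psi> \<theta>) ((push \<omega> G ^^ n) \<psi> \<theta>) = \<psi> \<theta>"
  shows "\<exists>\<gamma>. continuous_on UNIV \<gamma> \<and> (\<forall>\<theta>. \<gamma> \<theta> = m (\<psi> \<theta>) (push \<omega> G \<gamma> \<theta>))"
proof -
  define E where "E \<gamma> \<theta> = m (\<psi> \<theta>) (push \<omega> G \<gamma> \<theta>)" for \<gamma> \<theta>
  define c where "c k = (E ^^ k) \<psi>" for k
  have c_Suc: "c (Suc k) \<theta> = m (\<psi> \<theta>) (push \<omega> G (c k) \<theta>)" for k \<theta>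
    by (simp add: c_def E_def)
  have c_cont: "continuous_on UNIV (c k)" for k
  proof (induction k)
    case 0
    then show ?case by (simp add: c_def \<psi>)
  next
    case (Suc k)
    have "c (Suc k) = (\<lambda>\<theta>. m (\<psi> \<theta>) (push \<omega> G (c k) \<theta>))"
      by (rule ext) (rule c_Suc)
    then show ?case
      using cont[OF \<psi> continuous_on_push[OF G Suc]] by (simp only:)
  qed
  have mono: "mono (G \<theta>)" for \<theta>
    using G unfolding fibre_lift_def by blast
  have c_eq: "c (Suc k) \<theta> = m (c k \<theta>) ((push \<omega> G ^^ Suc k) \<psi> \<theta>)" for k \<theta>
  proof (induction k arbitrary: \<theta>)
    case 0
    then show ?case by (simp add: c_Suc) (simp add: c_def)
  next
    case (Suc k)
    have "push \<omega> G (c (Suc k)) \<theta> = m (push \<omega> G (c k) \<theta>) (push \<omega> G ((push \<omega> G ^^ Suc k) \<psi>) \<theta>)"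
      unfolding push_def Suc by (simp add: distr[OF mono] push_def)
    then show ?case
      by (subst c_Suc) (simp add: c_Suc[of k] assoc)
  qed
  have absorb: "m (c k \<theta>) ((push \<omega> G ^^ n) \<psi> \<theta>) = c k \<theta>" for k \<theta>
  proof (cases k)
    case 0
    then show ?thesis using n(2) by (simp add: c_def)
  next
    case (Suc j)
    have "m (m x y) z = m x y" if "m x z = x" for x y z
      using that assoc[of x y z] assoc[of x z y] comm[of y z] by simp
    from this[OF n(2)] show ?thesis unfolding Suc c_Suc .
  qed
  obtain k where k: "n = Suc k" using n(1) by (metis Suc_pred)
  show ?thesis
  proof (intro exI conjI allI)
    show "continuous_on UNIV (c k)" by (rule c_cont)
    show "c k \<theta> = m (\<psi> \<theta>) (push \<omega> G (c k) \<theta>)" for \<theta>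
      using c_eq[of k \<theta>] absorb[of k \<theta>] by (simp only: c_Suc k)
  qed
qed

text \<open>The lower envelope \<open>\<psi>\<close> of the zero curve along \<open>U\<close> satisfies \<open>\<psi>(\<theta> + \<omega>) \<le> U \<theta> (\<psi> \<theta>)\<close>.  Let \<open>\<gamma>\<close> be
  the upper envelope of \<open>\<psi>\<close> along \<open>L\<close>.  Then \<open>\<gamma>(\<theta> + \<omega>)\<close> is either \<open>L \<theta> (\<gamma> \<theta>)\<close>, or else \<open>\<psi>(\<theta> + \<omega>)\<close>,
  which lies above \<open>L \<theta> (\<gamma> \<theta>)\<close> and below \<open>U \<theta> (\<psi> \<theta>) \<le> U \<theta> (\<gamma> \<theta>)\<close>.\<close>

lemma approximately_invariant_curve:
  assumes L: "fibre_lift L" "has_rotation \<omega> L \<rho>" "\<rho> < 0"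
    and U: "fibre_lift U" "has_rotation \<omega> U \<sigma>" "0 < \<sigma>"
    and LU: "\<And>\<theta> w. L \<theta> w \<le> U \<theta> w"
  obtains \<gamma> where "continuous_on UNIV \<gamma>"
    "\<And>\<theta>. L \<theta> (\<gamma> \<theta>) \<le> \<gamma> (\<theta> + \<omega>)" "\<And>\<theta>. \<gamma> (\<theta> + \<omega>) \<le> U \<theta> (\<gamma> \<theta>)"
proof -
  obtain n where n: "n > 0" "\<And>\<theta>. 0 \<le> sgn \<sigma> * ((push \<omega> U ^^ n) (\<lambda>_. 0) \<theta> - 0)"
    using orbit_drift[OF U(1,2), of "\<lambda>_. 0"] U(3) by auto
  have "\<exists>\<psi>. continuous_on UNIV \<psi> \<and> (\<forall>\<theta>. \<psi> \<theta> = min 0 (push \<omega> U \<psi> \<theta>))"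
    by (rule envelope_curve[where m = min and n = n])
      (use n U in \<open>auto simp: min_of_mono ac_simps intro!: continuous_intros\<close>)
  then obtain \<psi> where \<psi>: "continuous_on UNIV \<psi>" "\<And>\<theta>. \<psi> \<theta> = min 0 (push \<omega> U \<psi> \<theta>)"
    by blast
  obtain m where m: "m > 0" "\<And>\<theta>. 0 \<le> sgn \<rho> * ((push \<omega> L ^^ m) \<psi> \<theta> - \<psi> \<theta>)"
    using orbit_drift[OF L(1,2) _ \<psi>(1)] L(3) by auto
  have "\<exists>\<gamma>. continuous_on UNIV \<gamma> \<and> (\<forall>\<theta>. \<gamma> \<theta> = max (\<psi> \<theta>) (push \<omega> L \<gamma> \<theta>))"
    by (rule envelope_curve[where m = max and n = m])
      (use m L \<psi>(1) in \<open>auto simp: max_of_mono ac_simps intro!: continuous_intros max_absorb1\<close>)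
  then obtain \<gamma> where \<gamma>: "continuous_on UNIV \<gamma>" "\<And>\<theta>. \<gamma> \<theta> = max (\<psi> \<theta>) (push \<omega> L \<gamma> \<theta>)"
    by blast
  show ?thesis
  proof
    fix \<theta>
    have \<gamma>': "\<gamma> (\<theta> + \<omega>) = max (\<psi> (\<theta> + \<omega>)) (L \<theta> (\<gamma> \<theta>))"
      using \<gamma>(2)[of "\<theta> + \<omega>"] by (simp add: push_def)
    then show "L \<theta> (\<gamma> \<theta>) \<le> \<gamma> (\<theta> + \<omega>)" by simp
    have "\<psi> (\<theta> + \<omega>) \<le> U \<theta> (\<psi> \<theta>)"
      using \<psi>(2)[of "\<theta> + \<omega>"] by (simp add: push_def)
    also have "\<dots> \<le> U \<theta> (\<gamma> \<theta>)"
      using \<gamma>(2)[of \<theta>] by (intro fibre_lift_mono[OF U(1)]) simp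
    finally show "\<gamma> (\<theta> + \<omega>) \<le> U \<theta> (\<gamma> \<theta>)"
      using LU[of \<theta> "\<gamma> \<theta>"] by (simp add: \<gamma>')
  qed (fact \<gamma>(1))
qed

text \<open>By monotonicity, orbits that start on such a curve stay above it and are therefore bounded from below.\<close>

lemma rotation_nonneg:
  assumes G: "fibre_lift G" "has_rotation \<omega> G \<rho>"
    and \<gamma>: "continuous_on UNIV \<gamma>" "\<And>\<theta>. \<gamma> (\<theta> + \<omega>) \<le> G \<theta> (\<gamma> \<theta>)"
  shows "0 \<le> \<rho>"
proof -
  obtain B where B: "B > 0" "\<And>\<theta>. \<bar>\<gamma> \<theta>\<bar> \<le> B" using circle_bounded[OF \<gamma>(1)] by blast
  have "\<gamma> (n \<cdot> \<omega>) \<le> orbit \<omega> G n 0 (\<gamma> 0)" for n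
  proof (induction n)
    case (Suc n)
    show ?case using order_trans[OF \<gamma>(2) fibre_lift_mono[OF G(1) Suc]] by simp
  qed simp
  then have "- B \<le> orbit \<omega> G n 0 (\<gamma> 0)" for n
    using B(2)[of "n \<cdot> \<omega>"] by (smt (verit))
  then have "- B / real n \<le> orbit \<omega> G n 0 (\<gamma> 0) / real n" for n
    by (intro divide_right_mono) auto
  then show ?thesis
    using LIMSEQ_le[OF lim_const_over_n[of "- B"] has_rotation_LIMSEQ[OF G, of 0 "\<gamma> 0"]] by blast
qed

lemma rotation_nonpos:
  assumes G: "fibre_lift G" "has_rotation \<omega> G \<rho>"
    and \<gamma>: "continuous_on UNIV \<gamma>" "\<And>\<theta>. G \<theta> (\<gamma> \<theta>) \<le> \<gamma> (\<theta> + \<omega>)"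
  shows "\<rho> \<le> 0"
proof -
  obtain B where B: "B > 0" "\<And>\<theta>. \<bar>\<gamma> \<theta>\<bar> \<le> B" using circle_bounded[OF \<gamma>(1)] by blast
  have "orbit \<omega> G n 0 (\<gamma> 0) \<le> \<gamma> (n \<cdot> \<omega>)" for n
  proof (induction n)
    case (Suc n)
    show ?case using order_trans[OF fibre_lift_mono[OF G(1) Suc] \<gamma>(2)] by simp
  qed simp
  then have "orbit \<omega> G n 0 (\<gamma> 0) \<le> B" for n
    using B(2)[of "n \<cdot> \<omega>"] by (smt (verit))
  then have "orbit \<omega> G n 0 (\<gamma> 0) / real n \<le> B / real n" for n
    by (intro divide_right_mono) auto
  then show ?thesis
    using LIMSEQ_le[OF has_rotation_LIMSEQ[OF G, of 0 "\<gamma> 0"] lim_const_over_n[of B]] by blast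
qed

text \<open>The height \<open>d\<close> times the base angle, followed continuously along the orbit, grows by \<open>d w\<close> per step,
  and the integer \<open>k\<close> per step is invisible to the sine.\<close>

lemma orbit_arnold_twist:
  assumes "\<omega> = to_circle w" and r: "r = of_int k + real d * w"
  shows "orbit \<omega> (arnold \<alpha> 0 \<phi>) n 0 0
    = orbit \<omega> (arnold \<alpha> d (\<lambda>\<theta>. \<phi> \<theta> - r)) n 0 0 + real n * r"
proof (induction n)
  case (Suc n)
  define y where "y = orbit \<omega> (arnold \<alpha> d (\<lambda>\<theta>. \<phi> \<theta> - r)) n 0 0"
  have "real n * r = of_int (int n * k) + real d * (real n * w)"
    by (simp add: r algebra_simps)
  then have "to_circle (y + real n * r)
      = to_circle y + (to_circle (of_int (int n * k)) + to_circle (real d * (real n * w)))"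
    by (simp only: to_circle_add)
  also have "\<dots> = to_circle y + d \<cdot> (n \<cdot> \<omega>)"
    unfolding to_circle_of_int by (simp add: assms(1) nmul_to_circle)
  finally have "arnold \<alpha> 0 \<phi> (0 + n \<cdot> \<omega>) (y + real n * r)
      = arnold \<alpha> d (\<lambda>\<theta>. \<phi> \<theta> - r) (0 + n \<cdot> \<omega>) y + real (Suc n) * r"
    unfolding arnold_def by (simp add: ring_distribs)
  then show ?case
    unfolding orbit.simps Suc y_def .
qed simp

lemma (in irrational_rotation) has_rotation_arnold_twist:
  assumes w: "\<omega> = to_circle w" and r: "r = of_int k + real d * w"
    and \<alpha>: "0 < \<alpha>" "\<alpha> < 1" and \<phi>: "continuous_on UNIV \<phi>"
  shows "has_rotation \<omega> (arnold \<alpha> d (\<lambda>\<theta>. \<phi> \<theta> - r)) (\<rho> - r) \<longleftrightarrow> has_rotation \<omega> (arnold \<alpha> 0 \<phi>) \<rho>"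
proof -
  let ?F = "arnold \<alpha> 0 \<phi>" and ?G = "arnold \<alpha> d (\<lambda>\<theta>. \<phi> \<theta> - r)"
  have F: "fibre_lift ?F" and G: "fibre_lift ?G"
    by (intro fibre_lift_arnold \<alpha> continuous_intros \<phi>)+
  obtain \<sigma> \<sigma>' where \<sigma>: "has_rotation \<omega> ?F \<sigma>" and \<sigma>': "has_rotation \<omega> ?G \<sigma>'"
    using rotation_exists[OF F] rotation_exists[OF G] by metis
  have uniq: "a = b" if "fibre_lift H" "has_rotation \<omega> H a" "has_rotation \<omega> H b" for H a b
    using has_rotation_LIMSEQ[OF that(1,2), of 0 0] has_rotation_LIMSEQ[OF that(1,3), of 0 0] LIMSEQ_unique
    by blast
  have "(\<lambda>n. orbit \<omega> ?G n 0 0 / real n + r) \<longlonglongrightarrow> \<sigma>' + r"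
    by (intro tendsto_add has_rotation_LIMSEQ[OF G \<sigma>'] tendsto_const)
  moreover have "\<forall>\<^sub>F n in sequentially. orbit \<omega> ?G n 0 0 / real n + r = orbit \<omega> ?F n 0 0 / real n"
    using eventually_gt_at_top[of 0]
  proof eventually_elim
    case (elim n)
    then show ?case
      using orbit_arnold_twist[OF w r, of \<alpha> \<phi> n] by (simp add: field_simps)
  qed
  ultimately have "(\<lambda>n. orbit \<omega> ?F n 0 0 / real n) \<longlonglongrightarrow> \<sigma>' + r"
    by (rule Lim_transform_eventually)
  then have "\<sigma> = \<sigma>' + r"
    using has_rotation_LIMSEQ[OF F \<sigma>] LIMSEQ_unique by blast
  then show ?thesis
    using uniq[OF F \<sigma>] uniq[OF G \<sigma>'] \<sigma> \<sigma>' by (metis add_diff_cancel_right' diff_add_cancel)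
qed

section \<open>Hyperbolic invariant curves\<close>

definition cos_circle :: "circle \<Rightarrow> real" where
  "cos_circle c = sin_circle (c + to_circle (1 / 4))"

lemma cos_circle_to_circle [simp]: "cos_circle (to_circle x) = cos (2 * pi * x)"
  unfolding cos_circle_def by (simp add: sin_cos_eq distrib_left flip: to_circle_add)

lemma sin_circle_quarter: "cos_circle (c + to_circle (1 / 4)) = - sin_circle c"
proof -
  obtain x where "c = to_circle x" by (rule to_circle_cases)
  then show ?thesis
    by (simp add: distrib_left cos_add flip: to_circle_add)
qed

lemma continuous_on_cos_circle [continuous_intros]:
  "continuous_on S f \<Longrightarrow> continuous_on S (\<lambda>x. cos_circle (f x))"
  unfolding cos_circle_def by (intro continuous_intros)

lemma abs_cos_circle_le: "\<bar>cos_circle c\<bar> \<le> 1"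
  unfolding cos_circle_def by simp

lemma sin_cos_circle_squares: "(sin_circle c)\<^sup>2 + (cos_circle c)\<^sup>2 = 1"
  by (cases c rule: to_circle_cases) simp

lemma sin_taylor: "\<bar>sin (a + b) - sin a - b * cos a\<bar> \<le> b\<^sup>2" for a b :: real
proof -
  have s: "\<bar>sin b - b\<bar> \<le> b\<^sup>2 / 2"
    using Maclaurin_sin_bound[of b 2] by (simp add: sin_coeff_def numeral_2_eq_2)
  have c: "\<bar>cos b - 1\<bar> \<le> b\<^sup>2 / 2"
  proof -
    have "cos b = 1 - 2 * (sin (b / 2))\<^sup>2"
      using cos_double_sin[of "b / 2"] by simp
    moreover have "(sin (b / 2))\<^sup>2 \<le> (b / 2)\<^sup>2"
      using abs_sin_x_le_abs_x[of "b / 2"] by (simp only: abs_le_square_iff)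
    ultimately show ?thesis by (simp add: power2_eq_square)
  qed
  have "sin (a + b) - sin a - b * cos a = sin a * (cos b - 1) + cos a * (sin b - b)"
    by (simp add: sin_add algebra_simps)
  also have "\<bar>\<dots>\<bar> \<le> \<bar>sin a\<bar> * \<bar>cos b - 1\<bar> + \<bar>cos a\<bar> * \<bar>sin b - b\<bar>"
    by (metis abs_mult abs_triangle_ineq)
  also have "\<dots> \<le> 1 * \<bar>cos b - 1\<bar> + 1 * \<bar>sin b - b\<bar>"
    by (intro add_mono mult_right_mono) auto
  finally show ?thesis using s c by simp
qed

lemma sin_circle_taylor:
  "\<bar>sin_circle (to_circle (x + t) + c) - sin_circle (to_circle x + c) - 2 * pi * t * cos_circle (to_circle x + c)\<bar>
    \<le> (2 * pi * t)\<^sup>2"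
proof -
  obtain s where "c = to_circle s" by (rule to_circle_cases)
  then show ?thesis
    using sin_taylor[of "2 * pi * (x + s)" "2 * pi * t"]
    by (simp add: algebra_simps flip: to_circle_add)
qed

lemma cos_circle_taylor:
  "\<bar>cos_circle (to_circle (x + t) + c) - cos_circle (to_circle x + c) + 2 * pi * t * sin_circle (to_circle x + c)\<bar>
    \<le> (2 * pi * t)\<^sup>2"
  using sin_circle_taylor[of x t "c + to_circle (1 / 4)"]
  by (simp add: cos_circle_def[symmetric] sin_circle_quarter flip: add.assoc)

text \<open>The fibre derivative of \<open>arnold \<alpha> d \<phi>\<close> along the graph of \<open>\<gamma>\<close>; it is the same for all forcings,
  as these translate the fibres.\<close>

definition slope :: "real \<Rightarrow> nat \<Rightarrow> (circle \<Rightarrow> real) \<Rightarrow> circle \<Rightarrow> real" where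
  "slope \<alpha> d \<gamma> \<theta> = 1 + \<alpha> * cos_circle (to_circle (\<gamma> \<theta>) + d \<cdot> \<theta>)"

lemma slope_pos:
  assumes "0 < \<alpha>" "\<alpha> < 1"
  shows "slope \<alpha> d \<gamma> \<theta> > 0"
proof -
  have "\<bar>\<alpha> * cos_circle (to_circle (\<gamma> \<theta>) + d \<cdot> \<theta>)\<bar> \<le> \<alpha> * 1"
    unfolding abs_mult using assms by (intro mult_mono abs_cos_circle_le) auto
  then show ?thesis unfolding slope_def using assms by linarith
qed

lemma continuous_on_slope [continuous_intros]:
  "continuous_on UNIV \<gamma> \<Longrightarrow> continuous_on UNIV (slope \<alpha> d \<gamma>)"
  unfolding slope_def by (intro continuous_intros)

lemma arnold_taylor:
  assumes "0 < \<alpha>" "\<alpha> < 1"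
  shows "\<bar>arnold \<alpha> d \<phi> \<theta> (\<gamma> \<theta> + t) - arnold \<alpha> d \<phi> \<theta> (\<gamma> \<theta>) - slope \<alpha> d \<gamma> \<theta> * t\<bar> \<le> 8 * t\<^sup>2"
proof -
  define A where "A = sin_circle (to_circle (\<gamma> \<theta> + t) + d \<cdot> \<theta>) - sin_circle (to_circle (\<gamma> \<theta>) + d \<cdot> \<theta>)
    - 2 * pi * t * cos_circle (to_circle (\<gamma> \<theta>) + d \<cdot> \<theta>)"
  have "arnold \<alpha> d \<phi> \<theta> (\<gamma> \<theta> + t) - arnold \<alpha> d \<phi> \<theta> (\<gamma> \<theta>) - slope \<alpha> d \<gamma> \<theta> * t = \<alpha> / (2 * pi) * A"
    by (simp add: arnold_def slope_def A_def algebra_simps)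
  also have "\<bar>\<dots>\<bar> \<le> \<alpha> / (2 * pi) * (2 * pi * t)\<^sup>2"
    unfolding abs_mult A_def using assms by (intro mult_mono sin_circle_taylor) auto
  also have "\<dots> = (2 * \<alpha> * pi) * t\<^sup>2"
    by (simp add: power2_eq_square)
  also have "\<dots> \<le> 8 * t\<^sup>2"
  proof (rule mult_right_mono)
    have "\<alpha> * pi \<le> 1 * 4"
      using assms pi_less_4 by (intro mult_mono) auto
    then show "2 * \<alpha> * pi \<le> 8" by linarith
  qed simp
  finally show ?thesis .
qed

text \<open>To first order, the image of the curve \<open>\<gamma> + \<delta> \<sigma> u\<close> lies \<open>\<delta> \<sigma> slope u\<close> above \<open>\<gamma>\<close>, which by
  hypothesis is below \<open>\<gamma> + \<delta> \<sigma> u\<close> by a margin proportional to \<open>\<delta>\<close>.  For small \<open>\<delta>\<close> this margin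
  beats the quadratic Taylor error and leaves room for raising the map, so the curve bounds the
  raised map from above; symmetrically \<open>\<gamma> - \<delta> \<sigma> u\<close> bounds the lowered map from below.  The sign
  \<open>\<sigma> = 1\<close> describes an attracting curve and \<open>\<sigma> = - 1\<close> a repelling one, for which the two sides
  exchange their roles.\<close>

lemma (in irrational_rotation) hyperbolic_curve_locks:
  assumes \<alpha>: "0 < \<alpha>" "\<alpha> < 1" and \<phi>: "continuous_on UNIV \<phi>"
    and \<gamma>: "continuous_on UNIV \<gamma>" "\<And>\<theta>. arnold \<alpha> d \<phi> \<theta> (\<gamma> \<theta>) = \<gamma> (\<theta> + \<omega>)"
    and u: "continuous_on UNIV u" and \<sigma>: "\<bar>\<sigma>\<bar> = 1"
    and hyp: "\<And>\<theta>. \<sigma> * (u (\<theta> + \<omega>) - slope \<alpha> d \<gamma> \<theta> * u \<theta>) > 0"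
  obtains \<epsilon> where "\<epsilon> > 0" "has_rotation \<omega> (arnold \<alpha> d (\<lambda>\<theta>. \<phi> \<theta> - \<epsilon>)) 0"
    "has_rotation \<omega> (arnold \<alpha> d (\<lambda>\<theta>. \<phi> \<theta> + \<epsilon>)) 0"
proof -
  have "continuous_on UNIV (\<lambda>\<theta>. \<sigma> * (u (\<theta> + \<omega>) - slope \<alpha> d \<gamma> \<theta> * u \<theta>))"
    by (intro continuous_intros \<gamma> u continuous_on_compose2[OF u]) auto
  then obtain \<kappa> where \<kappa>: "\<kappa> > 0" "\<And>\<theta>. \<kappa> \<le> \<sigma> * (u (\<theta> + \<omega>) - slope \<alpha> d \<gamma> \<theta> * u \<theta>)"
    using circle_pos_lower_bound hyp by blast
  obtain B where B: "B > 0" "\<And>\<theta>. \<bar>u \<theta>\<bar> \<le> B" using circle_bounded[OF u] by blast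
  (* With this value the Taylor error 8 (delta B)^2 is half of the margin delta kappa; the other
     half is the amount epsilon by which the map may be raised or lowered. *)
  define \<delta> where "\<delta> = \<kappa> / (16 * B\<^sup>2)"
  have \<delta>: "\<delta> > 0" using \<kappa> B by (simp add: \<delta>_def)
  define \<epsilon> where "\<epsilon> = \<delta> * \<kappa> / 2"
  have \<epsilon>: "\<epsilon> > 0" using \<delta> \<kappa> by (simp add: \<epsilon>_def)
  have err: "8 * (\<delta> * (\<sigma> * u \<theta>))\<^sup>2 \<le> \<epsilon>" for \<theta>
  proof -
    have "(\<sigma> * u \<theta>)\<^sup>2 \<le> B\<^sup>2"
      using B(2)[of \<theta>] \<sigma> B(1) by (intro abs_le_square_iff[THEN iffD1]) (simp add: abs_mult)
    then have "8 * (\<delta> * (\<sigma> * u \<theta>))\<^sup>2 \<le> 8 * (\<delta>\<^sup>2 * B\<^sup>2)"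
      unfolding power_mult_distrib[of \<delta>] by (intro mult_left_mono) auto
    also have "\<dots> = \<epsilon>"
      using B(1) by (simp add: \<epsilon>_def \<delta>_def power2_eq_square field_simps)
    finally show ?thesis .
  qed
  let ?L = "arnold \<alpha> d (\<lambda>\<theta>. \<phi> \<theta> - \<epsilon>)" and ?U = "arnold \<alpha> d (\<lambda>\<theta>. \<phi> \<theta> + \<epsilon>)"
  have L: "fibre_lift ?L" and U: "fibre_lift ?U"
    by (intro fibre_lift_arnold \<alpha> continuous_intros \<phi>)+
  obtain a b where a: "has_rotation \<omega> ?L a" and b: "has_rotation \<omega> ?U b"
    using rotation_exists[OF L] rotation_exists[OF U] by metis
  have shift: "?L \<theta> w = arnold \<alpha> d \<phi> \<theta> w - \<epsilon>" "?U \<theta> w = arnold \<alpha> d \<phi> \<theta> w + \<epsilon>" for \<theta> w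
    by (simp_all add: arnold_def)
  have gap: "\<delta> * (\<sigma> * (slope \<alpha> d \<gamma> \<theta> * u \<theta>)) + 2 * \<epsilon> \<le> \<delta> * (\<sigma> * u (\<theta> + \<omega>))" for \<theta>
  proof -
    have "\<delta> * \<kappa> \<le> \<delta> * (\<sigma> * (u (\<theta> + \<omega>) - slope \<alpha> d \<gamma> \<theta> * u \<theta>))"
      using \<kappa>(2) \<delta> by (intro mult_left_mono) auto
    then show ?thesis by (simp add: \<epsilon>_def algebra_simps)
  qed
  have "b \<le> 0"
  proof (rule rotation_nonpos[OF U b, of "\<lambda>\<theta>. \<gamma> \<theta> + \<delta> * (\<sigma> * u \<theta>)"])
    show "?U \<theta> (\<gamma> \<theta> + \<delta> * (\<sigma> * u \<theta>)) \<le> \<gamma> (\<theta> + \<omega>) + \<delta> * (\<sigma> * u (\<theta> + \<omega>))" for \<theta>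
      using arnold_taylor[OF \<alpha>, of d \<phi> \<theta> \<gamma> "\<delta> * (\<sigma> * u \<theta>)"] err[of \<theta>] gap[of \<theta>]
      unfolding shift \<gamma>(2) by (simp add: algebra_simps)
  qed (intro continuous_intros \<gamma> u)
  moreover have "0 \<le> a"
  proof (rule rotation_nonneg[OF L a, of "\<lambda>\<theta>. \<gamma> \<theta> - \<delta> * (\<sigma> * u \<theta>)"])
    show "\<gamma> (\<theta> + \<omega>) - \<delta> * (\<sigma> * u (\<theta> + \<omega>)) \<le> ?L \<theta> (\<gamma> \<theta> - \<delta> * (\<sigma> * u \<theta>))" for \<theta>
      using arnold_taylor[OF \<alpha>, of d \<phi> \<theta> \<gamma> "- (\<delta> * (\<sigma> * u \<theta>))"] err[of \<theta>] gap[of \<theta>]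
      unfolding shift \<gamma>(2) by (simp add: algebra_simps)
  qed (intro continuous_intros \<gamma> u)
  moreover have "a \<le> b"
    using has_rotation_mono[OF L U a b] \<epsilon> by (simp add: shift)
  ultimately have "a = 0" "b = 0" by auto
  with a b \<epsilon> show ?thesis by (intro that[of \<epsilon>]) auto
qed

text \<open>Let \<open>v\<close> be the mean of the first \<open>n\<close> Birkhoff sums of \<open>l\<close>.  Then \<open>l(\<theta>) + v(\<theta> + \<omega>) - v(\<theta>)\<close> is the
  \<open>n\<close>-step average of \<open>l\<close> at \<open>\<theta>\<close>, so that the weight \<open>exp (- v)\<close> turns a sign condition on \<open>n\<close> steps
  into one on a single step.\<close>

lemma cohomologous_weight:
  assumes l: "continuous_on UNIV l" and n: "n > 0" and \<sigma>: "\<bar>\<sigma>\<bar> = 1"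
    and sign: "\<And>\<theta>. \<sigma> * birkhoff \<omega> l n \<theta> < 0"
  obtains u :: "circle \<Rightarrow> real" where "continuous_on UNIV u"
    "\<And>\<theta>. \<sigma> * (u (\<theta> + \<omega>) - exp (l \<theta>) * u \<theta>) > 0"
proof
  define v where "v \<theta> = (\<Sum>i<n. birkhoff \<omega> l i \<theta>) / real n" for \<theta>
  define u where "u \<theta> = exp (- v \<theta>)" for \<theta>
  show "continuous_on UNIV u"
    unfolding u_def v_def using n by (intro continuous_intros l) auto
  fix \<theta>
  have "(\<Sum>i<n. birkhoff \<omega> l i (\<theta> + \<omega>)) = (\<Sum>i<n. birkhoff \<omega> l i \<theta>) + birkhoff \<omega> l n \<theta> - real n * l \<theta>"
  proof -
    have "birkhoff \<omega> l i (\<theta> + \<omega>) = birkhoff \<omega> l i \<theta> + l (\<theta> + i \<cdot> \<omega>) - l \<theta>" for i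
      using birkhoff_shift[of \<omega> l i \<theta> 1] by (simp add: birkhoff_def)
    then show ?thesis
      by (simp add: sum.distrib sum_subtractf birkhoff_def[of \<omega> l n])
  qed
  then have v: "v (\<theta> + \<omega>) = v \<theta> + birkhoff \<omega> l n \<theta> / real n - l \<theta>"
    using n by (simp add: v_def field_simps)
  define A where "A = birkhoff \<omega> l n \<theta> / real n"
  have "- v (\<theta> + \<omega>) = l \<theta> + - v \<theta> + - A"
    by (simp add: v A_def)
  then have "u (\<theta> + \<omega>) = exp (l \<theta>) * u \<theta> * exp (- A)"
    unfolding u_def by (simp only: exp_add)
  then have "u (\<theta> + \<omega>) - exp (l \<theta>) * u \<theta> = exp (l \<theta>) * u \<theta> * (exp (- A) - 1)"
    by (simp add: algebra_simps)
  moreover have "\<sigma> * (exp (- A) - 1) > 0"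
  proof -
    have "\<sigma> * A < 0"
      using sign[of \<theta>] n by (simp add: A_def divide_less_0_iff)
    then show ?thesis using \<sigma> by (cases "\<sigma> = 1") (auto simp: abs_if split: if_splits)
  qed
  ultimately show "\<sigma> * (u (\<theta> + \<omega>) - exp (l \<theta>) * u \<theta>) > 0"
    by (simp add: u_def mult.left_commute[of \<sigma>])
qed

section \<open>Forcings close to a given one with a mode-locked map\<close>

context irrational_rotation
begin

text \<open>For every length the Birkhoff sum of \<open>l\<close> is non-negative somewhere, hence at least \<open>- o(n)\<close>
  everywhere.  Every orbit visits the neighbourhood of \<open>\<theta>\<^sub>0\<close> where \<open>l' - l\<close> is bounded away from zero
  at least once in any \<open>N\<close> consecutive steps, so the sums of the non-negative function \<open>l' - l\<close>
  grow linearly.\<close>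

lemma birkhoff_pos_of_dominating:
  assumes l: "continuous_on UNIV l" and l': "continuous_on UNIV l'"
    and neutral: "\<And>n. n > 0 \<Longrightarrow> \<exists>\<theta>. birkhoff \<omega> l n \<theta> \<ge> 0"
    and le: "\<And>\<theta>. l \<theta> \<le> l' \<theta>" and less: "l \<theta>\<^sub>0 < l' \<theta>\<^sub>0"
  obtains n where "n > 0" "\<And>\<theta>. birkhoff \<omega> l' n \<theta> > 0"
proof -
  define p where "p \<theta> = l' \<theta> - l \<theta>" for \<theta>
  have p: "continuous_on UNIV p" unfolding p_def by (intro continuous_intros l l')
  have p0: "p \<theta> \<ge> 0" for \<theta> using le by (simp add: p_def)
  define c where "c = p \<theta>\<^sub>0 / 2"
  have "c > 0" using less by (simp add: c_def p_def)
  obtain \<delta> where \<delta>: "\<delta> > 0" "\<And>\<theta>. dist \<theta> \<theta>\<^sub>0 < \<delta> \<Longrightarrow> dist (p \<theta>) (p \<theta>\<^sub>0) < c"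
    using p \<open>c > 0\<close> unfolding continuous_on_iff by (metis UNIV_I)
  obtain K where K: "\<And>\<theta> \<theta>'. \<exists>k\<le>K. dist (\<theta> + k \<cdot> \<omega>) \<theta>' < \<delta>"
    using uniformly_minimal[OF \<delta>(1)] by blast
  define N where "N = Suc K"
  have gain1: "c \<le> birkhoff \<omega> p N \<theta>" for \<theta>
  proof -
    obtain k where k: "k \<le> K" "dist (\<theta> + k \<cdot> \<omega>) \<theta>\<^sub>0 < \<delta>" using K by blast
    have "c \<le> p (\<theta> + k \<cdot> \<omega>)"
      using \<delta>(2)[OF k(2)] unfolding dist_real_def c_def by linarith
    also have "\<dots> \<le> birkhoff \<omega> p N \<theta>"
      unfolding birkhoff_def N_def
      by (rule member_le_sum[where f = "\<lambda>i. p (\<theta> + i \<cdot> \<omega>)"]) (use k p0 in auto)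
    finally show ?thesis .
  qed
  have gain: "real j * c \<le> birkhoff \<omega> p (j * N) \<theta>" for j \<theta>
  proof (induction j arbitrary: \<theta>)
    case 0
    then show ?case by (simp add: birkhoff_def)
  next
    case (Suc j)
    have "birkhoff \<omega> p (Suc j * N) \<theta> = birkhoff \<omega> p (j * N) (\<theta> + N \<cdot> \<omega>) + birkhoff \<omega> p N \<theta>"
      using birkhoff_shift[of \<omega> p "j * N" \<theta> N] by (simp add: add.commute)
    then show ?case
      using Suc[of "\<theta> + N \<cdot> \<omega>"] gain1[of \<theta>] by (simp add: algebra_simps)
  qed
  define e where "e = c / (2 * real N)"
  have "e > 0" using \<open>c > 0\<close> by (simp add: e_def N_def)
  obtain n\<^sub>0 where n\<^sub>0: "\<And>n \<theta> \<theta>'. n \<ge> n\<^sub>0 \<Longrightarrow> \<bar>birkhoff \<omega> l n \<theta> - birkhoff \<omega> l n \<theta>'\<bar> \<le> e * real n"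
    using birkhoff_oscillation[OF l \<open>e > 0\<close>] by blast
  define n where "n = Suc n\<^sub>0 * N"
  have n: "n > 0" "n \<ge> n\<^sub>0" by (auto simp: n_def N_def)
  show ?thesis
  proof
    show "n > 0" by (fact n)
    fix \<theta>
    obtain \<theta>' where "birkhoff \<omega> l n \<theta>' \<ge> 0" using neutral[OF n(1)] by blast
    then have "birkhoff \<omega> l n \<theta> \<ge> - (e * real n)"
      using n\<^sub>0[OF n(2), of \<theta> \<theta>'] by linarith
    moreover have "e * real n = real (Suc n\<^sub>0) * c / 2"
      by (simp add: e_def n_def N_def field_simps)
    moreover have "real (Suc n\<^sub>0) * c \<le> birkhoff \<omega> p n \<theta>"
      unfolding n_def by (rule gain)
    moreover have "real (Suc n\<^sub>0) * c > 0" using \<open>c > 0\<close> by simp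
    moreover have "birkhoff \<omega> l' n \<theta> = birkhoff \<omega> l n \<theta> + birkhoff \<omega> p n \<theta>"
      unfolding birkhoff_def p_def by (simp add: sum_subtractf)
    ultimately show "birkhoff \<omega> l' n \<theta> > 0" by linarith
  qed
qed

text \<open>Suppose that no Birkhoff sum of the logarithmic fibre derivative along \<open>\<gamma>\<close> has a strict sign.  Moving
  the curve towards the maximum of the cosine, from \<open>x\<close> to \<open>x - s sin(2\<pi>x)\<close>, increases the fibre
  derivative wherever the sine does not vanish, and this makes the sums positive.  The sine cannot
  vanish along all of \<open>\<gamma>\<close>: the cosine would then have one strict sign on the whole connected circle,
  and the fibre derivative would stay on one side of \<open>1\<close>.\<close>

lemma nonzero_exponent_curve:
  assumes \<alpha>: "0 < \<alpha>" "\<alpha> < 1" and \<gamma>: "continuous_on UNIV \<gamma>" and "\<eta> > 0"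
  obtains \<gamma>' \<sigma> n where "continuous_on UNIV \<gamma>'" "\<And>\<theta>. \<bar>\<gamma>' \<theta> - \<gamma> \<theta>\<bar> \<le> \<eta>" "\<bar>\<sigma>\<bar> = (1::real)" "n > 0"
    "\<And>\<theta>. \<sigma> * birkhoff \<omega> (\<lambda>\<theta>. ln (slope \<alpha> d \<gamma>' \<theta>)) n \<theta> < 0"
proof (cases "\<exists>\<sigma> n. \<bar>\<sigma>\<bar> = (1::real) \<and> n > 0 \<and> (\<forall>\<theta>. \<sigma> * birkhoff \<omega> (\<lambda>\<theta>. ln (slope \<alpha> d \<gamma> \<theta>)) n \<theta> < 0)")
  case True
  then obtain \<sigma> :: real and n where "\<bar>\<sigma>\<bar> = 1" "n > 0"
      "\<And>\<theta>. \<sigma> * birkhoff \<omega> (\<lambda>\<theta>. ln (slope \<alpha> d \<gamma> \<theta>)) n \<theta> < 0"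
    by blast
  with that[of \<gamma> \<sigma> n] \<gamma> \<open>\<eta> > 0\<close> show ?thesis by simp
next
  case False
  define l where "l \<gamma> \<theta> = ln (slope \<alpha> d \<gamma> \<theta>)" for \<gamma> \<theta>
  have no_sign: "\<exists>\<theta>. \<sigma> * birkhoff \<omega> (l \<gamma>) n \<theta> \<ge> 0" if "\<bar>\<sigma>\<bar> = 1" "n > 0" for \<sigma> n
    using False that unfolding l_def by (meson not_less)
  have l_cont: "continuous_on UNIV (l \<gamma>)" if "continuous_on UNIV \<gamma>" for \<gamma>
    unfolding l_def using that slope_pos[OF \<alpha>, of d \<gamma>]
    by (intro continuous_intros ballI) (auto simp: less_le)
  define y where "y \<theta> = to_circle (\<gamma> \<theta>) + d \<cdot> \<theta>" for \<theta>
  have y: "continuous_on UNIV y" unfolding y_def by (intro continuous_intros \<gamma>)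
  (* The bound 1/8 keeps a = 2 pi s below 1, so that the first-order gain a sin^2 dominates the
     second-order loss a^2 sin^2. *)
  define s where "s = min \<eta> (1 / 8)"
  have s: "0 < s" "s \<le> \<eta>" "s \<le> 1 / 8" using \<open>\<eta> > 0\<close> by (auto simp: s_def)
  define a where "a = 2 * pi * s"
  have a: "0 < a" "a < 1"
  proof -
    have "a \<le> 2 * pi * (1 / 8)" unfolding a_def using s by (intro mult_left_mono) auto
    then show "a < 1" using pi_less_4 by simp
  qed (use s in \<open>simp add: a_def\<close>)
  define \<gamma>' where "\<gamma>' \<theta> = \<gamma> \<theta> + - s * sin_circle (y \<theta>)" for \<theta>
  have \<gamma>': "continuous_on UNIV \<gamma>'" unfolding \<gamma>'_def by (intro continuous_intros \<gamma> y)
  have close: "\<bar>\<gamma>' \<theta> - \<gamma> \<theta>\<bar> \<le> \<eta>" for \<theta>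
  proof -
    have "\<bar>\<gamma>' \<theta> - \<gamma> \<theta>\<bar> = s * \<bar>sin_circle (y \<theta>)\<bar>"
      using s by (simp add: \<gamma>'_def abs_mult)
    also have "\<dots> \<le> s * 1" using s by (intro mult_left_mono) auto
    finally show ?thesis using s by simp
  qed
  have gain: "a * (1 - a) * (sin_circle (y \<theta>))\<^sup>2 \<le> cos_circle (to_circle (\<gamma>' \<theta>) + d \<cdot> \<theta>) - cos_circle (y \<theta>)" for \<theta>
  proof -
    define S where "S = sin_circle (y \<theta>)"
    have "\<bar>cos_circle (to_circle (\<gamma>' \<theta>) + d \<cdot> \<theta>) - cos_circle (y \<theta>) + 2 * pi * (- s * S) * S\<bar> \<le> (2 * pi * (- s * S))\<^sup>2"
      unfolding \<gamma>'_def S_def y_def by (rule cos_circle_taylor)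
    moreover have "2 * pi * (- s * S) * S = - (a * S\<^sup>2)" "(2 * pi * (- s * S))\<^sup>2 = a\<^sup>2 * S\<^sup>2"
      by (simp_all add: a_def power2_eq_square)
    ultimately have "\<bar>cos_circle (to_circle (\<gamma>' \<theta>) + d \<cdot> \<theta>) - cos_circle (y \<theta>) + - (a * S\<^sup>2)\<bar> \<le> a\<^sup>2 * S\<^sup>2"
      by (simp only:)
    moreover have "a * (1 - a) * S\<^sup>2 = a * S\<^sup>2 - a\<^sup>2 * S\<^sup>2"
      by (simp add: power2_eq_square algebra_simps)
    ultimately show ?thesis unfolding S_def by linarith
  qed
  have sl: "slope \<alpha> d \<gamma> \<theta> = 1 + \<alpha> * cos_circle (y \<theta>)" for \<theta>
    by (simp add: slope_def y_def)
  have le: "l \<gamma> \<theta> \<le> l \<gamma>' \<theta>" for \<theta>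
  proof -
    have "0 \<le> a * (1 - a) * (sin_circle (y \<theta>))\<^sup>2" using a by simp
    then have "slope \<alpha> d \<gamma> \<theta> \<le> slope \<alpha> d \<gamma>' \<theta>"
      using gain[of \<theta>] \<alpha> unfolding sl by (simp add: slope_def)
    then show ?thesis unfolding l_def using slope_pos[OF \<alpha>] by simp
  qed
  have "\<exists>\<theta>\<^sub>0. sin_circle (y \<theta>\<^sub>0) \<noteq> 0"
  proof (rule ccontr)
    assume "\<nexists>\<theta>\<^sub>0. sin_circle (y \<theta>\<^sub>0) \<noteq> 0"
    then have nz: "cos_circle (y \<theta>) \<noteq> 0" for \<theta>
      using sin_cos_circle_squares[of "y \<theta>"] by auto
    have conn: "connected (range (\<lambda>\<theta>. cos_circle (y \<theta>)))"
      by (intro connected_continuous_image connected_circle continuous_intros y)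
    have "\<not> (cos_circle (y \<theta>) \<le> 0 \<and> 0 \<le> cos_circle (y \<eta>))" for \<theta> \<eta>
      using connectedD_interval[OF conn rangeI rangeI, of \<theta> 0 \<eta>] nz by auto
    then have "(\<forall>\<theta>. cos_circle (y \<theta>) < 0) \<or> (\<forall>\<theta>. cos_circle (y \<theta>) > 0)"
      by (meson not_less)
    then show False
    proof
      assume neg: "\<forall>\<theta>. cos_circle (y \<theta>) < 0"
      have "l \<gamma> \<theta> < 0" for \<theta>
        unfolding l_def using slope_pos[OF \<alpha>, of d \<gamma> \<theta>] \<alpha> neg by (simp add: sl mult_pos_neg)
      then show False using no_sign[of 1 1] by (auto simp: birkhoff_def not_le[symmetric])
    next
      assume pos: "\<forall>\<theta>. cos_circle (y \<theta>) > 0"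
      have "l \<gamma> \<theta> > 0" for \<theta>
      proof -
        have "\<alpha> * cos_circle (y \<theta>) > 0" using \<alpha> pos by simp
        then show ?thesis unfolding l_def sl by (intro ln_gt_zero) simp
      qed
      then show False using no_sign[of "- 1" 1] by (auto simp: birkhoff_def not_le[symmetric])
    qed
  qed
  then obtain \<theta>\<^sub>0 where \<theta>\<^sub>0: "sin_circle (y \<theta>\<^sub>0) \<noteq> 0" by blast
  have "0 < a * (1 - a) * (sin_circle (y \<theta>\<^sub>0))\<^sup>2" using a \<theta>\<^sub>0 by simp
  then have "slope \<alpha> d \<gamma> \<theta>\<^sub>0 < slope \<alpha> d \<gamma>' \<theta>\<^sub>0"
    using gain[of \<theta>\<^sub>0] \<alpha> unfolding sl by (simp add: slope_def)
  then have "l \<gamma> \<theta>\<^sub>0 < l \<gamma>' \<theta>\<^sub>0" unfolding l_def using slope_pos[OF \<alpha>] by simp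
  then obtain n where "n > 0" "\<And>\<theta>. birkhoff \<omega> (l \<gamma>') n \<theta> > 0"
    using birkhoff_pos_of_dominating[OF l_cont[OF \<gamma>] l_cont[OF \<gamma>'] _ le] no_sign[of 1] by auto
  then show ?thesis
    using that[OF \<gamma>' close, of "- 1" n] unfolding l_def by simp
qed

text \<open>The forcing is changed by at most \<open>\<epsilon>\<close> to make the approximately invariant curve invariant, and by
  at most another \<open>\<epsilon>\<close> to compensate for moving that curve by \<open>\<epsilon> / 3\<close>: one third at the end point,
  two thirds at the starting point, where the fibre maps have Lipschitz constant less than \<open>2\<close>.\<close>

lemma mode_locked_dense:
  assumes \<alpha>: "0 < \<alpha>" "\<alpha> < 1" and \<beta>: "\<beta> \<noteq> 0" and q: "continuous_on UNIV q" and "e > 0"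
  obtains q' where "continuous_on UNIV q'" "\<And>\<theta>. \<bar>q' \<theta> - q \<theta>\<bar> \<le> e"
    "mode_locked \<omega> (forced_arnold_map \<omega> \<alpha> \<beta> \<tau> q')"
proof -
  define \<phi> where "\<phi> \<theta> = \<tau> + \<beta> * q \<theta>" for \<theta>
  have \<phi>: "continuous_on UNIV \<phi>" unfolding \<phi>_def by (intro continuous_intros q)
  define \<epsilon> where "\<epsilon> = e * \<bar>\<beta>\<bar> / 2"
  have \<epsilon>: "\<epsilon> > 0" using \<open>e > 0\<close> \<beta> by (simp add: \<epsilon>_def)
  have lift: "fibre_lift (arnold \<alpha> 0 (\<lambda>\<theta>. \<phi> \<theta> - \<epsilon>))" "fibre_lift (arnold \<alpha> 0 (\<lambda>\<theta>. \<phi> \<theta> + \<epsilon>))"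
    by (intro fibre_lift_arnold \<alpha> continuous_intros \<phi>)+
  obtain \<rho>\<^sub>1 \<rho>\<^sub>2 where \<rho>\<^sub>1: "has_rotation \<omega> (arnold \<alpha> 0 (\<lambda>\<theta>. \<phi> \<theta> - \<epsilon>)) \<rho>\<^sub>1"
    and \<rho>\<^sub>2: "has_rotation \<omega> (arnold \<alpha> 0 (\<lambda>\<theta>. \<phi> \<theta> + \<epsilon>)) \<rho>\<^sub>2"
    using rotation_exists[OF lift(1)] rotation_exists[OF lift(2)] by metis
  have "\<rho>\<^sub>1 \<le> \<rho>\<^sub>2"
    by (rule has_rotation_mono[OF lift \<rho>\<^sub>1 \<rho>\<^sub>2]) (use \<epsilon> in \<open>simp add: arnold_def\<close>)
  then consider "\<rho>\<^sub>1 = \<rho>\<^sub>2" | "\<rho>\<^sub>1 < \<rho>\<^sub>2" by linarith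
  then show ?thesis
  proof cases
    case 1
    then have "mode_locked \<omega> (forced_arnold_map \<omega> \<alpha> \<beta> \<tau> q)"
      using arnold_mode_lockedI[OF \<alpha> q \<epsilon>] \<rho>\<^sub>1 \<rho>\<^sub>2 unfolding \<phi>_def by blast
    then show ?thesis using that[OF q] \<open>e > 0\<close> by simp
  next
    case 2
    obtain w where w: "w \<notin> \<rat>" "\<omega> = to_circle w" by (rule real_rep)
    obtain d k where "\<rho>\<^sub>1 < of_int k + real d * w" "of_int k + real d * w < \<rho>\<^sub>2"
      by (rule lattice_dense[OF w(1) 2])
    then obtain r where r: "r = of_int k + real d * w" "\<rho>\<^sub>1 < r" "r < \<rho>\<^sub>2" by blast
    define G where "G = arnold \<alpha> d (\<lambda>\<theta>. \<phi> \<theta> - r)"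
    let ?L = "arnold \<alpha> d (\<lambda>\<theta>. \<phi> \<theta> - \<epsilon> - r)" and ?U = "arnold \<alpha> d (\<lambda>\<theta>. \<phi> \<theta> + \<epsilon> - r)"
    have L: "fibre_lift ?L" "has_rotation \<omega> ?L (\<rho>\<^sub>1 - r)"
      by (intro fibre_lift_arnold \<alpha> continuous_intros \<phi>)
        (subst has_rotation_arnold_twist[OF w(2) r(1) \<alpha>], intro continuous_intros \<phi>, fact)
    have U: "fibre_lift ?U" "has_rotation \<omega> ?U (\<rho>\<^sub>2 - r)"
      by (intro fibre_lift_arnold \<alpha> continuous_intros \<phi>)
        (subst has_rotation_arnold_twist[OF w(2) r(1) \<alpha>], intro continuous_intros \<phi>, fact)
    have LGU: "?L \<theta> x = G \<theta> x - \<epsilon>" "?U \<theta> x = G \<theta> x + \<epsilon>" for \<theta> x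
      by (simp_all add: G_def arnold_def)
    obtain \<gamma>\<^sub>0 where \<gamma>\<^sub>0: "continuous_on UNIV \<gamma>\<^sub>0"
      "\<And>\<theta>. ?L \<theta> (\<gamma>\<^sub>0 \<theta>) \<le> \<gamma>\<^sub>0 (\<theta> + \<omega>)" "\<And>\<theta>. \<gamma>\<^sub>0 (\<theta> + \<omega>) \<le> ?U \<theta> (\<gamma>\<^sub>0 \<theta>)"
    proof (rule approximately_invariant_curve[OF L _ U])
      show "\<rho>\<^sub>1 - r < 0" "0 < \<rho>\<^sub>2 - r" using r by simp_all
      show "?L \<theta> x \<le> ?U \<theta> x" for \<theta> x using \<epsilon> unfolding LGU by simp
    qed blast
    have "\<epsilon> / 3 > 0" using \<epsilon> by simp
    then obtain \<gamma> \<sigma> n where \<gamma>: "continuous_on UNIV \<gamma>" "\<And>\<theta>. \<bar>\<gamma> \<theta> - \<gamma>\<^sub>0 \<theta>\<bar> \<le> \<epsilon> / 3"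
      and sign: "\<bar>\<sigma>\<bar> = (1 :: real)" "n > 0"
        "\<And>\<theta>. \<sigma> * birkhoff \<omega> (\<lambda>\<theta>. ln (slope \<alpha> d \<gamma> \<theta>)) n \<theta> < 0"
      using nonzero_exponent_curve[OF \<alpha> \<gamma>\<^sub>0(1), of "\<epsilon> / 3" d] by blast
    (* The unique forcing for which the curve is invariant. *)
    define \<psi> where "\<psi> \<theta> = \<phi> \<theta> + (\<gamma> (\<theta> + \<omega>) - G \<theta> (\<gamma> \<theta>))" for \<theta>
    have G: "fibre_lift G"
      unfolding G_def by (intro fibre_lift_arnold \<alpha> continuous_intros \<phi>)
    have \<psi>: "continuous_on UNIV \<psi>"
      unfolding \<psi>_def
      by (intro continuous_intros \<phi> fibre_lift_continuous[OF G] \<gamma> continuous_on_compose2[OF \<gamma>(1)]) auto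
    have inv: "arnold \<alpha> d (\<lambda>\<theta>. \<psi> \<theta> - r) \<theta> (\<gamma> \<theta>) = \<gamma> (\<theta> + \<omega>)" for \<theta>
      by (simp add: \<psi>_def G_def arnold_def)
    have close: "\<bar>\<psi> \<theta> - \<phi> \<theta>\<bar> \<le> 2 * \<epsilon>" for \<theta>
    proof -
      have "\<bar>\<gamma>\<^sub>0 (\<theta> + \<omega>) - G \<theta> (\<gamma>\<^sub>0 \<theta>)\<bar> \<le> \<epsilon>"
        using \<gamma>\<^sub>0(2,3)[of \<theta>] unfolding LGU by linarith
      moreover have "\<bar>G \<theta> (\<gamma> \<theta>) - G \<theta> (\<gamma>\<^sub>0 \<theta>)\<bar> \<le> 2 * (\<epsilon> / 3)"
      proof -
        define h where "h x = \<alpha> / (2 * pi) * sin_circle (to_circle x + d \<cdot> \<theta>)" for x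
        have "\<bar>h (\<gamma> \<theta>) - h (\<gamma>\<^sub>0 \<theta>)\<bar> \<le> \<alpha> * \<bar>\<gamma> \<theta> - \<gamma>\<^sub>0 \<theta>\<bar>"
          unfolding h_def using \<alpha> by (intro abs_sine_term_diff_le) simp
        also have "\<dots> \<le> 1 * \<bar>\<gamma> \<theta> - \<gamma>\<^sub>0 \<theta>\<bar>"
          using \<alpha> by (intro mult_right_mono) auto
        also have "\<dots> \<le> \<epsilon> / 3" using \<gamma>(2)[of \<theta>] by simp
        finally have "\<bar>h (\<gamma> \<theta>) - h (\<gamma>\<^sub>0 \<theta>)\<bar> \<le> \<epsilon> / 3" .
        moreover have "G \<theta> (\<gamma> \<theta>) - G \<theta> (\<gamma>\<^sub>0 \<theta>) = (\<gamma> \<theta> - \<gamma>\<^sub>0 \<theta>) + (h (\<gamma> \<theta>) - h (\<gamma>\<^sub>0 \<theta>))"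
          by (simp add: G_def arnold_def h_def)
        ultimately show ?thesis using \<gamma>(2)[of \<theta>] by linarith
      qed
      ultimately show ?thesis
        using \<gamma>(2)[of "\<theta> + \<omega>"] unfolding \<psi>_def by linarith
    qed
    have "continuous_on UNIV (\<lambda>\<theta>. ln (slope \<alpha> d \<gamma> \<theta>))"
      using slope_pos[OF \<alpha>, of d \<gamma>] by (intro continuous_intros \<gamma> ballI) (auto simp: less_le)
    then obtain u where u: "continuous_on UNIV u"
      "\<And>\<theta>. \<sigma> * (u (\<theta> + \<omega>) - exp (ln (slope \<alpha> d \<gamma> \<theta>)) * u \<theta>) > 0"
      using cohomologous_weight[OF _ sign(2,1,3)] by blast
    then have u': "\<sigma> * (u (\<theta> + \<omega>) - slope \<alpha> d \<gamma> \<theta> * u \<theta>) > 0" for \<theta>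
      using slope_pos[OF \<alpha>, of d \<gamma> \<theta>] by (metis exp_ln)
    have "continuous_on UNIV (\<lambda>\<theta>. \<psi> \<theta> - r)" by (intro continuous_intros \<psi>)
    then obtain \<delta> where \<delta>: "\<delta> > 0" "has_rotation \<omega> (arnold \<alpha> d (\<lambda>\<theta>. \<psi> \<theta> - r - \<delta>)) 0"
      "has_rotation \<omega> (arnold \<alpha> d (\<lambda>\<theta>. \<psi> \<theta> - r + \<delta>)) 0"
      using hyperbolic_curve_locks[OF \<alpha> _ \<gamma>(1) inv u(1) sign(1) u'] by blast
    have rot: "has_rotation \<omega> (arnold \<alpha> 0 (\<lambda>\<theta>. \<psi> \<theta> - \<delta>)) r" "has_rotation \<omega> (arnold \<alpha> 0 (\<lambda>\<theta>. \<psi> \<theta> + \<delta>)) r"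
      using has_rotation_arnold_twist[OF w(2) r(1) \<alpha>, of "\<lambda>\<theta>. \<psi> \<theta> - \<delta>" r]
        has_rotation_arnold_twist[OF w(2) r(1) \<alpha>, of "\<lambda>\<theta>. \<psi> \<theta> + \<delta>" r] \<delta>
      by (simp_all add: continuous_intros \<psi> algebra_simps)
    define q' where "q' \<theta> = (\<psi> \<theta> - \<tau>) / \<beta>" for \<theta>
    have q': "continuous_on UNIV q'"
      unfolding q'_def using \<beta> by (intro continuous_intros \<psi>) auto
    have eq: "\<tau> + \<beta> * q' \<theta> = \<psi> \<theta>" for \<theta> using \<beta> by (simp add: q'_def)
    show ?thesis
    proof (rule that[OF q'])
      show "mode_locked \<omega> (forced_arnold_map \<omega> \<alpha> \<beta> \<tau> q')"
        using arnold_mode_lockedI[OF \<alpha> q' \<delta>(1), of \<tau> \<beta> r] rot unfolding eq by blast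
      fix \<theta>
      have "\<bar>\<beta>\<bar> * \<bar>q' \<theta> - q \<theta>\<bar> = \<bar>\<psi> \<theta> - \<phi> \<theta>\<bar>"
        unfolding abs_mult[symmetric] using eq[of \<theta>] by (simp add: \<phi>_def algebra_simps)
      also have "\<dots> \<le> \<bar>\<beta>\<bar> * e" using close[of \<theta>] by (simp add: \<epsilon>_def mult.commute)
      finally show "\<bar>q' \<theta> - q \<theta>\<bar> \<le> e" using \<beta> by simp
    qed
  qed
qed

end

section \<open>Genericity in the forcing and in the parameters\<close>

lemma mode_locked_stable:
  assumes "mode_locked \<omega> f"
  shows "\<exists>\<epsilon>>0. \<forall>f'. forced_circle_homeo \<omega> f' \<and> (\<forall>z. dist (f' z) (f z) \<le> \<epsilon>) \<longrightarrow> mode_locked \<omega> f'"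
proof -
  obtain \<epsilon> where \<epsilon>: "\<epsilon> > 0" and lock: "\<And>f'. forced_circle_homeo \<omega> f' \<Longrightarrow> (\<And>z. dist (f' z) (f z) < \<epsilon>)
      \<Longrightarrow> rotation_number \<omega> f' = rotation_number \<omega> f"
    using assms unfolding mode_locked_def by blast
  show ?thesis
  proof (intro exI conjI allI impI)
    show "\<epsilon> / 3 > 0" using \<epsilon> by simp
    fix f' assume "forced_circle_homeo \<omega> f' \<and> (\<forall>z. dist (f' z) (f z) \<le> \<epsilon> / 3)"
    then have f': "forced_circle_homeo \<omega> f'" "\<And>z. dist (f' z) (f z) \<le> \<epsilon> / 3" by blast+
    have "rotation_number \<omega> f'' = rotation_number \<omega> f'"
      if f'': "forced_circle_homeo \<omega> f''" "\<forall>z. dist (f'' z) (f' z) < \<epsilon> / 3" for f''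
    proof -
      have "dist (f'' z) (f z) < \<epsilon>" for z
        using dist_triangle[of "f'' z" "f z" "f' z"] f'(2)[of z] f''(2)[rule_format, of z] \<epsilon> by linarith
      moreover have "dist (f' z) (f z) < \<epsilon>" for z
        using f'(2)[of z] \<epsilon> by linarith
      ultimately have "rotation_number \<omega> f'' = rotation_number \<omega> f" "rotation_number \<omega> f' = rotation_number \<omega> f"
        using lock f'(1) f''(1) by blast+
      then show ?thesis by simp
    qed
    moreover have "\<epsilon> / 3 > 0" using \<epsilon> by simp
    ultimately show "mode_locked \<omega> f'"
      unfolding mode_locked_def using f'(1) by blast
  qed
qed

text \<open>One estimate serves both for the openness in the forcing and for the openness in the parameters.\<close>

lemma dist_forced_arnold_map_le:
  "dist (forced_arnold_map \<omega> \<alpha> \<beta> \<tau> q z) (forced_arnold_map \<omega> \<alpha>' \<beta> \<tau>' q' z)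
    \<le> \<bar>\<tau> - \<tau>'\<bar> + \<bar>\<alpha> - \<alpha>'\<bar> + \<bar>\<beta>\<bar> * \<bar>q (fst z) - q' (fst z)\<bar>"
proof -
  obtain \<theta> x where z: "z = (\<theta>, to_circle x)" by (metis surj_pair to_circle_cases)
  define s where "s = sin_circle (to_circle x) / (2 * pi)"
  have s: "\<bar>s\<bar> \<le> 1"
  proof -
    have "\<bar>sin_circle (to_circle x)\<bar> \<le> 2 * pi"
      using abs_sin_circle_le[of "to_circle x"] pi_gt3 by linarith
    then show ?thesis by (simp add: s_def)
  qed
  have "dist (forced_arnold_map \<omega> \<alpha> \<beta> \<tau> q z) (forced_arnold_map \<omega> \<alpha>' \<beta> \<tau>' q' z)
      \<le> \<bar>arnold \<alpha> 0 (\<lambda>\<theta>. \<tau> + \<beta> * q \<theta>) \<theta> x - arnold \<alpha>' 0 (\<lambda>\<theta>. \<tau>' + \<beta> * q' \<theta>) \<theta> x\<bar>"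
    unfolding z forced_arnold_map_to_circle dist_prod_def using dist_to_circle_le by simp
  also have "arnold \<alpha> 0 (\<lambda>\<theta>. \<tau> + \<beta> * q \<theta>) \<theta> x - arnold \<alpha>' 0 (\<lambda>\<theta>. \<tau>' + \<beta> * q' \<theta>) \<theta> x
      = (\<tau> - \<tau>') + (\<alpha> - \<alpha>') * s + \<beta> * (q \<theta> - q' \<theta>)"
    by (simp add: arnold_def s_def algebra_simps diff_divide_distrib)
  also have "\<bar>\<dots>\<bar> \<le> \<bar>\<tau> - \<tau>'\<bar> + \<bar>\<alpha> - \<alpha>'\<bar> * \<bar>s\<bar> + \<bar>\<beta>\<bar> * \<bar>q \<theta> - q' \<theta>\<bar>"
    unfolding abs_mult[symmetric] by linarith
  also have "\<dots> \<le> \<bar>\<tau> - \<tau>'\<bar> + \<bar>\<alpha> - \<alpha>'\<bar> * 1 + \<bar>\<beta>\<bar> * \<bar>q \<theta> - q' \<theta>\<bar>"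
    using s by (intro add_mono mult_left_mono) auto
  finally show ?thesis by (simp add: z)
qed

lemma apply_bcontfun_continuous: "continuous_on UNIV (apply_bcontfun q)"
  using apply_bcontfun[of q] by (simp add: bcontfun_def)

lemma open_mode_locked_forcings:
  assumes "0 < \<alpha>" "\<alpha> < 1"
  shows "open {q :: circle \<Rightarrow>\<^sub>C real. mode_locked \<omega> (forced_arnold_map \<omega> \<alpha> \<beta> \<tau> (apply_bcontfun q))}"
  unfolding open_dist
proof (intro ballI, unfold mem_Collect_eq)
  fix q :: "circle \<Rightarrow>\<^sub>C real"
  assume "mode_locked \<omega> (forced_arnold_map \<omega> \<alpha> \<beta> \<tau> q)"
  then obtain \<epsilon> where \<epsilon>: "\<epsilon> > 0" and stable: "\<And>f'. forced_circle_homeo \<omega> f' \<Longrightarrow>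
      (\<And>z. dist (f' z) (forced_arnold_map \<omega> \<alpha> \<beta> \<tau> q z) \<le> \<epsilon>) \<Longrightarrow> mode_locked \<omega> f'"
    using mode_locked_stable by blast
  show "\<exists>e>0. \<forall>q'. dist q' q < e \<longrightarrow> mode_locked \<omega> (forced_arnold_map \<omega> \<alpha> \<beta> \<tau> q')"
  proof (intro exI conjI allI impI)
    show "\<epsilon> / (\<bar>\<beta>\<bar> + 1) > 0" using \<epsilon> by simp
    fix q' :: "circle \<Rightarrow>\<^sub>C real" assume q': "dist q' q < \<epsilon> / (\<bar>\<beta>\<bar> + 1)"
    show "mode_locked \<omega> (forced_arnold_map \<omega> \<alpha> \<beta> \<tau> q')"
    proof (rule stable[OF forced_circle_homeo_arnold[OF assms apply_bcontfun_continuous]])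
      fix z :: "circle \<times> circle"
      have "\<bar>q' (fst z) - q (fst z)\<bar> \<le> \<epsilon> / (\<bar>\<beta>\<bar> + 1)"
        using dist_bounded[of q' "fst z" q] q' by (simp add: dist_real_def)
      then have "\<bar>\<beta>\<bar> * \<bar>q' (fst z) - q (fst z)\<bar> \<le> (\<bar>\<beta>\<bar> + 1) * (\<epsilon> / (\<bar>\<beta>\<bar> + 1))"
        by (intro mult_mono) auto
      then show "dist (forced_arnold_map \<omega> \<alpha> \<beta> \<tau> q' z) (forced_arnold_map \<omega> \<alpha> \<beta> \<tau> q z) \<le> \<epsilon>"
        using dist_forced_arnold_map_le[of \<omega> \<alpha> \<beta> \<tau> q' z \<alpha> \<tau> q] by simp
    qed
  qed
qed

lemma dense_mode_locked_forcings:
  assumes "\<omega> \<in> to_circle ` (UNIV - \<rat>)" "\<beta> \<noteq> 0" "0 < \<alpha>" "\<alpha> < 1"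
  shows "closure {q :: circle \<Rightarrow>\<^sub>C real. mode_locked \<omega> (forced_arnold_map \<omega> \<alpha> \<beta> \<tau> (apply_bcontfun q))} = UNIV"
proof -
  interpret irrational_rotation \<omega> by unfold_locales fact
  have "\<exists>q'\<in>{q. mode_locked \<omega> (forced_arnold_map \<omega> \<alpha> \<beta> \<tau> (apply_bcontfun q))}. dist q' q < e"
    if e: "e > 0" for q :: "circle \<Rightarrow>\<^sub>C real" and e
  proof -
    obtain q' where q': "continuous_on UNIV q'" "\<And>\<theta>. \<bar>q' \<theta> - q \<theta>\<bar> \<le> e / 2"
      "mode_locked \<omega> (forced_arnold_map \<omega> \<alpha> \<beta> \<tau> q')"
      using mode_locked_dense[OF assms(3,4,2) apply_bcontfun_continuous[of q] half_gt_zero[OF e], of \<tau>]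
      by blast
    have app: "apply_bcontfun (Bcontfun q') = q'"
      using q'(1) by (simp add: bcontfun_circle_iff Bcontfun_inverse)
    have "dist (Bcontfun q') q \<le> e / 2"
      by (rule dist_bound) (use q'(2) in \<open>simp add: app dist_real_def\<close>)
    then show ?thesis using q'(3) app e by (intro bexI[of _ "Bcontfun q'"]) auto
  qed
  then show ?thesis by (auto simp: closure_approachable)
qed

lemma open_mode_locked_parameters:
  assumes q: "continuous_on UNIV q"
  shows "open {(\<tau>, \<alpha>). \<alpha> \<in> {0<..<1} \<and> mode_locked \<omega> (forced_arnold_map \<omega> \<alpha> \<beta> \<tau> q)}" (is "open ?S")
  unfolding open_dist
proof
  fix p assume "p \<in> ?S"
  then obtain \<tau> \<alpha> where p: "p = (\<tau>, \<alpha>)" "0 < \<alpha>" "\<alpha> < 1"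
    and "mode_locked \<omega> (forced_arnold_map \<omega> \<alpha> \<beta> \<tau> q)" by auto
  then obtain \<epsilon> where \<epsilon>: "\<epsilon> > 0" and stable: "\<And>f'. forced_circle_homeo \<omega> f' \<Longrightarrow>
      (\<And>z. dist (f' z) (forced_arnold_map \<omega> \<alpha> \<beta> \<tau> q z) \<le> \<epsilon>) \<Longrightarrow> mode_locked \<omega> f'"
    using mode_locked_stable by blast
  define \<delta> where "\<delta> = min (\<epsilon> / 2) (min \<alpha> (1 - \<alpha>))"
  show "\<exists>e>0. \<forall>p'. dist p' p < e \<longrightarrow> p' \<in> ?S"
  proof (intro exI conjI allI impI)
    show "\<delta> > 0" using \<epsilon> p by (simp add: \<delta>_def)
    fix p' assume d: "dist p' p < \<delta>"
    obtain \<tau>' \<alpha>' where p': "p' = (\<tau>', \<alpha>')" by fastforce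
    have "\<bar>\<tau>' - \<tau>\<bar> < \<delta>" "\<bar>\<alpha>' - \<alpha>\<bar> < \<delta>"
      using d dist_fst_le[of p' p] dist_snd_le[of p' p] by (auto simp: p p' dist_real_def)
    then have "0 < \<alpha>'" "\<alpha>' < 1" and small: "\<bar>\<tau>' - \<tau>\<bar> + \<bar>\<alpha>' - \<alpha>\<bar> \<le> \<epsilon>"
      unfolding \<delta>_def by linarith+
    moreover have "mode_locked \<omega> (forced_arnold_map \<omega> \<alpha>' \<beta> \<tau>' q)"
    proof (rule stable[OF forced_circle_homeo_arnold[OF \<open>0 < \<alpha>'\<close> \<open>\<alpha>' < 1\<close> q]])
      show "dist (forced_arnold_map \<omega> \<alpha>' \<beta> \<tau>' q z) (forced_arnold_map \<omega> \<alpha> \<beta> \<tau> q z) \<le> \<epsilon>" for z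
        using dist_forced_arnold_map_le[of \<omega> \<alpha>' \<beta> \<tau>' q z \<alpha> \<tau> q] small by simp
    qed
    ultimately show "p' \<in> ?S" by (simp add: p')
  qed
qed

theorem theorem1p11:
  fixes \<omega> :: circle and \<beta> :: real
  assumes "\<omega> \<in> to_circle ` (UNIV - \<rat>)"
    and "\<beta> \<noteq> 0"
  shows "\<exists>\<U> :: (circle \<Rightarrow>\<^sub>C real) set. residual \<U> \<and>
    (\<forall>q\<in>\<U>.
      let X = top_of_set ((UNIV :: real set) \<times> {0<..<1 :: real});
          S = {(\<tau>, \<alpha>). \<alpha> \<in> {0<..<1} \<and>
                 mode_locked \<omega> (forced_arnold_map \<omega> \<alpha> \<beta> \<tau> (apply_bcontfun q))}
      in openin X S \<and> X closure_of S = topspace X)"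
proof -
  define P where "P = (UNIV :: real set) \<times> {0<..<1 :: real}"
  obtain C :: "(real \<times> real) set" where C: "countable C" "C \<subseteq> P" "P \<subseteq> closure C"
    by (rule separable)
  define V where "V p = {q :: circle \<Rightarrow>\<^sub>C real.
    mode_locked \<omega> (forced_arnold_map \<omega> (snd p) \<beta> (fst p) (apply_bcontfun q))}" for p
  have "residual (\<Inter>(V ` C))"
    unfolding residual_def
  proof (intro exI conjI ballI)
    show "countable (V ` C)" using C(1) by simp
    fix G assume "G \<in> V ` C"
    then obtain p where p: "G = V p" "0 < snd p" "snd p < 1" using C(2) by (auto simp: P_def)
    then show "open G" "closure G = UNIV"
      unfolding p(1) V_def
      using open_mode_locked_forcings dense_mode_locked_forcings[OF assms] by auto
  qed simp
  moreover have "openin (top_of_set P) S \<and> top_of_set P closure_of S = topspace (top_of_set P)"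
    if q: "q \<in> \<Inter>(V ` C)" and S: "S = {(\<tau>, \<alpha>). \<alpha> \<in> {0<..<1} \<and>
      mode_locked \<omega> (forced_arnold_map \<omega> \<alpha> \<beta> \<tau> (apply_bcontfun q))}" for q S
  proof
    have "S \<subseteq> P" by (auto simp: S P_def)
    moreover have "open S"
      unfolding S by (rule open_mode_locked_parameters[OF apply_bcontfun_continuous])
    ultimately show "openin (top_of_set P) S" by (simp add: open_subset)
    have "C \<subseteq> S" using q C(2) by (auto simp: S V_def P_def)
    then have "P \<subseteq> closure S" using C(3) closure_mono by blast
    then show "top_of_set P closure_of S = topspace (top_of_set P)"
      using \<open>S \<subseteq> P\<close> by (auto simp: closure_of_subtopology Int_absorb1)
  qed
  ultimately show ?thesis
    unfolding P_def[symmetric] Let_def by blast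
qed

end
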